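(* Let $p$ be an odd prime and let $H=\langle a,b,c,d\rangle$ be the $p$-group of nilpotency class $2$ defined by the additional relations $$a^p=[a,c],\qquad b^p=[a,bcd],\qquad c^p=[b,cd],\qquad d^p=[b,d].$$ Let $\langle w\rangle$ be a cyclic group of order $p^3$, let $M\leq H'$ be a subgroup of order $p$ with $M\nsubseteq H^p$, and let $G_2=H\rtimes_M\langle w\rangle$, where $w$ normalizes $H$ via the following non-inner central automorphism of $H$: $$waw^{-1}=ad^p,\qquad wbw^{-1}=b,\qquad wcw^{-1}=c,\qquad wdw^{-1}=d.$$ Then $G_2$ is a non-special $p$-group of order $p^{12}$ and the following hold: (1) If $M=\langle [a,b]\rangle$, then $G_2$ is a Miller group. (2) If $M=\langle [a,d]\rangle$, then $G_2$ is not a Miller group.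
   Context: Notation: $[x,y]=xyx^{-1}y^{-1}$; $H'$ is the commutator subgroup of $H$; $H^p=\langle h^p : h\in H\rangle$; $\Phi(H)$ is the Frattini subgroup and $Z(H)$ the center. The group $H$ is the group presented by generators $a,b,c,d$ subject to the relations $[[x,y],u]=1$ for all $x,y,u$ (nilpotency class at most $2$) together with the displayed relations; it is a finite $p$-group of order $p^{10}$. A Miller group is a non-abelian group whose automorphism group is abelian. A $p$-group $K$ is special if $Z(K)=K'=\Phi(K)$. An automorphism of a group $K$ is central if it induces the identity on $K/Z(K)$. Amalgamated semi-direct product: a group $G$ is the amalgamated semi-direct product of subgroups $H$ by $K$ over $M$, written $G=H\rtimes_M K$, if $H\trianglelefteq G$, $G=HK$ and $H\cap K=M$. (Externally: $M\leq H$ is identified with a subgroup of $K$ by an injective homomorphism, compatibly with a given action of $K$ on $H$.) Here $K=\langle w\rangle$ has order $p^3$, $w$ acts on $H$ by conjugation as displayed, and $H\cap\langle w\rangle=M=\langle w^{p^2}\rangle$. *)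

theory Defs
  imports "HOL-Algebra.Algebra" "HOL-Computational_Algebra.Primes"
begin

text \<open>
  A presentation is a set \<open>R\<close> of pairs \<open>(s, t)\<close> of group terms, read as relations \<open>s = t\<close>.
  The presented group consists of all group terms modulo the least congruence that
  contains \<open>R\<close> and makes the quotient a group.
\<close>

datatype 'x gterm =
    Gen 'x
  | Unit
  | Mult "'x gterm" "'x gterm"
  | Inv "'x gterm"

inductive pres_eq :: "('x gterm \<times> 'x gterm) set \<Rightarrow> 'x gterm \<Rightarrow> 'x gterm \<Rightarrow> bool"
  for R where
  rel: "(s, t) \<in> R \<Longrightarrow> pres_eq R s t"
| refl: "pres_eq R s s"
| sym: "pres_eq R s t \<Longrightarrow> pres_eq R t s"
| trans: "pres_eq R s t \<Longrightarrow> pres_eq R t u \<Longrightarrow> pres_eq R s u"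
| cong_Mult: "pres_eq R s s' \<Longrightarrow> pres_eq R t t' \<Longrightarrow> pres_eq R (Mult s t) (Mult s' t')"
| cong_Inv: "pres_eq R s s' \<Longrightarrow> pres_eq R (Inv s) (Inv s')"
| assoc: "pres_eq R (Mult (Mult s t) u) (Mult s (Mult t u))"
| l_one: "pres_eq R (Mult Unit s) s"
| l_inv: "pres_eq R (Mult (Inv s) s) Unit"

definition pres_class :: "('x gterm \<times> 'x gterm) set \<Rightarrow> 'x gterm \<Rightarrow> 'x gterm set" where
  "pres_class R s = {t. pres_eq R s t}"

definition presented_group :: "('x gterm \<times> 'x gterm) set \<Rightarrow> 'x gterm set monoid" where
  "presented_group R =
    \<lparr>carrier = range (pres_class R),
     monoid.mult = (\<lambda>S T. \<Union>s\<in>S. \<Union>t\<in>T. pres_class R (Mult s t)),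
     one = pres_class R Unit\<rparr>"

lemma pres_class_eq_iff: "pres_class R s = pres_class R t \<longleftrightarrow> pres_eq R s t"
  unfolding pres_class_def by (blast intro: pres_eq.refl pres_eq.sym pres_eq.trans)

lemma mult_presented_group [simp]:
  "pres_class R s \<otimes>\<^bsub>presented_group R\<^esub> pres_class R t = pres_class R (Mult s t)"
  unfolding presented_group_def pres_class_def
  by (auto intro: pres_eq.refl pres_eq.trans pres_eq.cong_Mult)

lemma group_presented_group: "group (presented_group R)"
proof (rule groupI)
  fix U assume "U \<in> carrier (presented_group R)"
  then obtain s where s: "U = pres_class R s" by (auto simp: presented_group_def)
  have "pres_class R (Inv s) \<otimes>\<^bsub>presented_group R\<^esub> U = \<one>\<^bsub>presented_group R\<^esub>"
    unfolding s mult_presented_group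
    by (simp add: presented_group_def pres_class_eq_iff pres_eq.l_inv)
  then show "\<exists>V\<in>carrier (presented_group R). V \<otimes>\<^bsub>presented_group R\<^esub> U = \<one>\<^bsub>presented_group R\<^esub>"
    by (auto simp: presented_group_def)
next
  have carrier: "carrier (presented_group R) = range (pres_class R)"
    and one: "\<one>\<^bsub>presented_group R\<^esub> = pres_class R Unit"
    by (simp_all add: presented_group_def)
  show "\<one>\<^bsub>presented_group R\<^esub> \<in> carrier (presented_group R)"
    by (simp add: carrier one)
  fix U assume U: "U \<in> carrier (presented_group R)"
  show "\<one>\<^bsub>presented_group R\<^esub> \<otimes>\<^bsub>presented_group R\<^esub> U = U"
    using U by (clarsimp simp: carrier one pres_class_eq_iff pres_eq.l_one)
  fix V assume V: "V \<in> carrier (presented_group R)"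
  show "U \<otimes>\<^bsub>presented_group R\<^esub> V \<in> carrier (presented_group R)"
    using U V by (auto simp: carrier)
  fix W assume W: "W \<in> carrier (presented_group R)"
  show "U \<otimes>\<^bsub>presented_group R\<^esub> V \<otimes>\<^bsub>presented_group R\<^esub> W
      = U \<otimes>\<^bsub>presented_group R\<^esub> (V \<otimes>\<^bsub>presented_group R\<^esub> W)"
    using U V W by (clarsimp simp: carrier pres_class_eq_iff pres_eq.assoc)
qed

text \<open>\<open>K\<close> is presented by \<open>R\<close>, the formal generator \<open>i\<close> corresponding to the element \<open>x i\<close>.\<close>

definition presented_by ::
  "('g, 'm) monoid_scheme \<Rightarrow> ('x gterm \<times> 'x gterm) set \<Rightarrow> ('x \<Rightarrow> 'g) \<Rightarrow> bool" where
  "presented_by K R x \<longleftrightarrow>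
    (\<exists>h \<in> iso (presented_group R) K. \<forall>i. h (pres_class R (Gen i)) = x i)"

definition Comm :: "'x gterm \<Rightarrow> 'x gterm \<Rightarrow> 'x gterm" where
  "Comm s t = Mult (Mult (Mult s t) (Inv s)) (Inv t)"

primrec Pow :: "'x gterm \<Rightarrow> nat \<Rightarrow> 'x gterm" where
  "Pow s 0 = Unit"
| "Pow s (Suc n) = Mult (Pow s n) s"

datatype H_gen = A | B | C | D

definition H_relations :: "nat \<Rightarrow> (H_gen gterm \<times> H_gen gterm) set" where
  "H_relations p =
    {(Comm (Comm s t) u, Unit) | s t u. True} \<union>
    {(Pow (Gen A) p, Comm (Gen A) (Gen C)),
     (Pow (Gen B) p, Comm (Gen A) (Mult (Mult (Gen B) (Gen C)) (Gen D))),
     (Pow (Gen C) p, Comm (Gen B) (Mult (Gen C) (Gen D))),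
     (Pow (Gen D) p, Comm (Gen B) (Gen D))}"

definition commutator :: "('g, 'm) monoid_scheme \<Rightarrow> 'g \<Rightarrow> 'g \<Rightarrow> 'g" where
  "commutator G x y = x \<otimes>\<^bsub>G\<^esub> y \<otimes>\<^bsub>G\<^esub> inv\<^bsub>G\<^esub> x \<otimes>\<^bsub>G\<^esub> inv\<^bsub>G\<^esub> y"

definition center :: "('g, 'm) monoid_scheme \<Rightarrow> 'g set" where
  "center G = {z \<in> carrier G. \<forall>x \<in> carrier G. z \<otimes>\<^bsub>G\<^esub> x = x \<otimes>\<^bsub>G\<^esub> z}"

definition maximal_subgroup :: "'g set \<Rightarrow> ('g, 'm) monoid_scheme \<Rightarrow> bool" where
  "maximal_subgroup N G \<longleftrightarrow>
    subgroup N G \<and> N \<noteq> carrier G \<and>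
    (\<forall>L. subgroup L G \<and> N \<subseteq> L \<longrightarrow> L = N \<or> L = carrier G)"

definition frattini :: "('g, 'm) monoid_scheme \<Rightarrow> 'g set" where
  "frattini G = carrier G \<inter> \<Inter> {N. maximal_subgroup N G}"

definition power_subgroup :: "('g, 'm) monoid_scheme \<Rightarrow> 'g set \<Rightarrow> nat \<Rightarrow> 'g set" where
  "power_subgroup G H n = generate G {h [^]\<^bsub>G\<^esub> n | h. h \<in> H}"

definition special_p_group :: "nat \<Rightarrow> ('g, 'm) monoid_scheme \<Rightarrow> bool" where
  "special_p_group p G \<longleftrightarrow>
    group G \<and> (\<exists>n. order G = p ^ n) \<and>
    center G = derived G (carrier G) \<and> derived G (carrier G) = frattini G"

definition central_automorphism :: "('g, 'm) monoid_scheme \<Rightarrow> ('g \<Rightarrow> 'g) \<Rightarrow> bool" where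
  "central_automorphism G f \<longleftrightarrow>
    f \<in> auto G \<and> (\<forall>x \<in> carrier G. center G #>\<^bsub>G\<^esub> f x = center G #>\<^bsub>G\<^esub> x)"

definition inner_automorphism :: "('g, 'm) monoid_scheme \<Rightarrow> ('g \<Rightarrow> 'g) \<Rightarrow> bool" where
  "inner_automorphism G f \<longleftrightarrow>
    (\<exists>g \<in> carrier G. f = (\<lambda>x \<in> carrier G. g \<otimes>\<^bsub>G\<^esub> x \<otimes>\<^bsub>G\<^esub> inv\<^bsub>G\<^esub> g))"

definition miller_group :: "('g, 'm) monoid_scheme \<Rightarrow> bool" where
  "miller_group G \<longleftrightarrow> group G \<and> \<not> comm_group G \<and> comm_group (AutoGroup G)"

definition amalgamated_semidirect_product ::
  "('g, 'm) monoid_scheme \<Rightarrow> 'g set \<Rightarrow> 'g set \<Rightarrow> 'g set \<Rightarrow> bool" where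
  "amalgamated_semidirect_product G H K M \<longleftrightarrow>
    H \<lhd> G \<and> subgroup K G \<and> carrier G = H <#>\<^bsub>G\<^esub> K \<and> H \<inter> K = M"

end

theory Submission
  imports Defs "HOL-Number_Theory.Cong"
begin

text \<open>
  The commutators
  \<open>[a,b], [a,c], [a,d], [b,c], [b,d], [c,d]\<close> are a basis of \<open>H'\<close>, the center of \<open>G\<close> is \<open>H' \<langle>w\<^sup>p\<rangle>\<close>,
  and any two automorphisms inducing the identity on \<open>G / Z(G)\<close> commute: each moves \<open>a, b, c, d\<close> by elements of \<open>H'\<close>,
  which it fixes, and \<open>w\<close> by an element of \<open>H' \<langle>w\<^sup>p\<rangle>\<close>.
  An automorphism acts on \<open>G / Z(G)\<close> by a matrix that is compatible with commutators and \<open>p\<close>-th powers. If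
  \<open>w\<close> to the power \<open>p\<^sup>2\<close> lies in \<open>\<langle>[a,b]\<rangle>\<close>, these equations force the identity matrix, so all
  automorphisms commute. If it equals \<open>[a,d]\<^sup>k\<close>, they admit the solution
  \<open>a \<mapsto> a w\<^sup>p, b \<mapsto> b w\<^sup>p, c \<mapsto> c d\<^sup>k, d \<mapsto> d, w \<mapsto> w\<close>,
  an automorphism that does not commute with conjugation by \<open>c\<close>.
\<close>

section \<open>Groups, words and automorphisms\<close>

text \<open>The two choices of \<open>M\<close> differ in what \<open>p\<close>-th powers can
  absorb. In the image of \<open>a\<close>, \<open>b\<close>, \<open>c\<close> or \<open>d\<close>
  the exponent of \<open>w\<close> is a multiple \<open>p * n'\<close>: the \<open>p\<close>-th
  power of the image is a commutator and so lies in \<open>H\<close>, which contains only those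
  powers of \<open>w\<close> whose exponent is divisible by \<open>p^2\<close>. That
  \<open>p\<close>-th power then carries a factor \<open>w^(p^2 * n')\<close>. For \<open>M\<close>
  generated by \<open>[a,b]\<close>, the unknown \<open>n'\<close> enters only the
  \<open>[a,b]\<close>-coordinates of the four power relations; the matrix equations leave these
  out, and the remaining ones still suffice. For \<open>M\<close> generated by \<open>[a,d]\<close>,
  the factor has the same shape as the change of \<open>[a,c]\<close> under
  \<open>c \<mapsto> c d^k\<close>, so it can be compensated. A second obstacle is that
  \<open>H\<close> is known only through its presentation, so that its commutators might collapse.
  Invariants of words that respect every derivable equation exclude this and yield the order of
  \<open>H\<close> without a concrete model of \<open>H\<close>.\<close>

lemma (in group) conj_int_pow:
  assumes "g \<in> carrier G" "x \<in> carrier G"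
  shows "(g \<otimes> x \<otimes> inv g) [^] (n::int) = g \<otimes> x [^] n \<otimes> inv g"
proof -
  have "(\<lambda>x. g \<otimes> x \<otimes> inv g) \<in> hom G G"
    using assms by (auto simp: hom_def m_assoc inv_solve_left)
  from hom_int_pow[OF this, of x n] show ?thesis
    using assms is_group by simp
qed

lemma (in group) int_pow_commute:
  assumes "x \<otimes> y = y \<otimes> x" "x \<in> carrier G" "y \<in> carrier G"
  shows "x [^] (n::int) \<otimes> y [^] (m::int) = y [^] m \<otimes> x [^] n"
proof -
  have one: "u [^] k \<otimes> v = v \<otimes> u [^] k"
    if "u \<otimes> v = v \<otimes> u" "u \<in> carrier G" "v \<in> carrier G" for u v and k :: int
    using conj_int_pow[of v u k] that by (metis int_pow_closed inv_solve_right m_closed)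
  show ?thesis
    using one[of x y n] one[of y "x [^] n" m] assms by simp
qed

text \<open>Conjugation by \<open>y\<close> sends \<open>x\<close> to \<open>x \<otimes> t\<close>,
  hence \<open>x [^] m\<close> to \<open>x [^] m \<otimes> t [^] m\<close>. Read from the other
  side, conjugation by \<open>inv (x [^] m)\<close> sends \<open>y\<close> to
  \<open>y \<otimes> t [^] m\<close>; taking \<open>n\<close>-th powers produces the exponent
  \<open>n * m\<close>.\<close>

lemma (in group) int_pow_mult_swap:
  assumes [simp]: "x \<in> carrier G" "y \<in> carrier G" "t \<in> carrier G"
    and yx: "y \<otimes> x = x \<otimes> y \<otimes> t" and tx: "t \<otimes> x = x \<otimes> t" and ty: "t \<otimes> y = y \<otimes> t"
  shows "y [^] (n::int) \<otimes> x [^] (m::int) = x [^] m \<otimes> (y [^] n \<otimes> t [^] (n * m))"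
proof -
  have "x \<otimes> t \<otimes> y = y \<otimes> x"
    by (simp add: yx ty m_assoc)
  then have "y \<otimes> x \<otimes> inv y = x \<otimes> t"
    by (metis assms(1-3) inv_solve_right m_closed)
  then have "y \<otimes> x [^] m \<otimes> inv y = x [^] m \<otimes> t [^] m"
    using conj_int_pow[of y x m] int_pow_mult_distrib[of x t m] tx by simp
  then have "y \<otimes> x [^] m = x [^] m \<otimes> t [^] m \<otimes> y"
    by (metis assms(1-3) inv_solve_right' int_pow_closed m_closed)
  also have "\<dots> = x [^] m \<otimes> (y \<otimes> t [^] m)"
    using int_pow_commute[of t y m 1] ty by (simp add: m_assoc)
  finally have "inv (x [^] m) \<otimes> (y \<otimes> x [^] m) = y \<otimes> t [^] m"
    by (metis assms(1-3) inv_solve_left' int_pow_closed m_closed)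
  then have "inv (x [^] m) \<otimes> y \<otimes> inv (inv (x [^] m)) = y \<otimes> t [^] m"
    by (simp add: m_assoc)
  then have "inv (x [^] m) \<otimes> y [^] n \<otimes> x [^] m = (y \<otimes> t [^] m) [^] n"
    using conj_int_pow[of "inv (x [^] m)" y n] by simp
  also have "\<dots> = y [^] n \<otimes> t [^] (n * m)"
    using int_pow_mult_distrib[of y "t [^] m" n] int_pow_commute[of t y m 1] ty
    by (simp add: int_pow_pow mult.commute)
  finally have "inv (x [^] m) \<otimes> (y [^] n \<otimes> x [^] m) = y [^] n \<otimes> t [^] (n * m)"
    by (simp add: m_assoc)
  then show ?thesis
    by (metis assms(1-3) inv_solve_left' int_pow_closed m_closed)
qed

text \<open>In a right-associated product the pair \<open>x \<otimes> y\<close> is hidden by a tail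
  \<open>u\<close>; this turns a swap rule into one that rewrites there.\<close>

lemma (in group) left_swap:
  assumes "x \<otimes> y = y \<otimes> z" "x \<in> carrier G" "y \<in> carrier G" "z \<in> carrier G" "u \<in> carrier G"
  shows "x \<otimes> (y \<otimes> u) = y \<otimes> (z \<otimes> u)"
  using assms by (metis m_assoc)

lemma (in group) int_pow_mult_assoc:
  "x \<in> carrier G \<Longrightarrow> y \<in> carrier G \<Longrightarrow> x [^] n \<otimes> (x [^] m \<otimes> y) = x [^] (n + m) \<otimes> y" for n m :: int
  by (simp add: int_pow_mult m_assoc)

section \<open>Centers and commutators in an arbitrary group\<close>

lemma centerD: "z \<in> center G \<Longrightarrow> x \<in> carrier G \<Longrightarrow> z \<otimes>\<^bsub>G\<^esub> x = x \<otimes>\<^bsub>G\<^esub> z"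
  by (simp add: center_def)

lemma center_carrier: "z \<in> center G \<Longrightarrow> z \<in> carrier G"
  by (simp add: center_def)

lemma centerI:
  "z \<in> carrier G \<Longrightarrow> (\<And>x. x \<in> carrier G \<Longrightarrow> z \<otimes>\<^bsub>G\<^esub> x = x \<otimes>\<^bsub>G\<^esub> z) \<Longrightarrow> z \<in> center G"
  by (simp add: center_def)

lemma (in group) center_subgroup: "subgroup (center G) G"
proof (rule subgroupI)
  show "center G \<subseteq> carrier G" using center_carrier[of _ G] by blast
  have "\<one> \<in> center G" by (rule centerI) simp_all
  then show "center G \<noteq> {}" by blast
next
  fix z assume z: "z \<in> center G"
  show "inv z \<in> center G"
  proof (rule centerI)
    show "inv z \<otimes> x = x \<otimes> inv z" if "x \<in> carrier G" for x
      using int_pow_commute[OF centerD[OF z that] center_carrier[OF z] that, of "-1" 1] center_carrier[OF z] that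
      by (simp add: int_pow_neg)
  qed (use center_carrier[OF z] in auto)
next
  fix y z assume yz: "y \<in> center G" "z \<in> center G"
  show "y \<otimes> z \<in> center G"
  proof (rule centerI)
    show "y \<otimes> z \<otimes> x = x \<otimes> (y \<otimes> z)" if "x \<in> carrier G" for x
      using yz that by (metis centerD center_carrier m_assoc)
  qed (use center_carrier[OF yz(1)] center_carrier[OF yz(2)] in auto)
qed

lemma (in group) commutator_closed [simp]:
  "x \<in> carrier G \<Longrightarrow> y \<in> carrier G \<Longrightarrow> commutator G x y \<in> carrier G"
  by (simp add: commutator_def)

lemma (in group) commutator_eqI:
  assumes "x \<in> carrier G" "y \<in> carrier G" "t \<in> carrier G" "x \<otimes> y = t \<otimes> (y \<otimes> x)"
  shows "commutator G x y = t"
  using assms unfolding commutator_def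
  by (metis inv_solve_right' m_assoc m_closed inv_closed)

lemma (in group) commutator_swap:
  assumes "x \<in> carrier G" "y \<in> carrier G"
  shows "x \<otimes> y = commutator G x y \<otimes> (y \<otimes> x)"
  using assms unfolding commutator_def
  by (metis inv_solve_right' m_assoc m_closed inv_closed)

lemma (in group) commutator_eq_one_iff:
  assumes "x \<in> carrier G" "y \<in> carrier G"
  shows "commutator G x y = \<one> \<longleftrightarrow> x \<otimes> y = y \<otimes> x"
  using assms commutator_swap[OF assms] commutator_eqI[OF assms one_closed] by auto

lemma (in group_hom) hom_commutator:
  assumes "x \<in> carrier G" "y \<in> carrier G"
  shows "h (commutator G x y) = commutator H (h x) (h y)"
  using assms by (simp add: commutator_def)

lemma (in group) commutator_center_mult_left:
  assumes z: "z \<in> center G" and "x \<in> carrier G" "y \<in> carrier G"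
  shows "commutator G (x \<otimes> z) y = commutator G x y"
proof (rule commutator_eqI)
  have zc: "z \<in> carrier G" using z by (rule center_carrier)
  show "x \<otimes> z \<otimes> y = commutator G x y \<otimes> (y \<otimes> (x \<otimes> z))"
    using assms(2,3) zc centerD[OF z, of y] commutator_swap[of x y]
    by (metis commutator_closed m_assoc m_closed)
qed (use assms center_carrier[OF z] in auto)

lemma (in group) commutator_center_mult_right:
  assumes z: "z \<in> center G" and "x \<in> carrier G" "y \<in> carrier G"
  shows "commutator G x (y \<otimes> z) = commutator G x y"
proof (rule commutator_eqI)
  have zc: "z \<in> carrier G" using z by (rule center_carrier)
  show "x \<otimes> (y \<otimes> z) = commutator G x y \<otimes> (y \<otimes> z \<otimes> x)"
    using assms(2,3) zc centerD[OF z, of x] commutator_swap[of x y]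
    by (metis commutator_closed m_assoc m_closed)
qed (use assms center_carrier[OF z] in auto)

lemma (in group) conj_commutator:
  assumes "x \<in> carrier G" "y \<in> carrier G" "g \<in> carrier G"
  shows "g \<otimes> commutator G x y \<otimes> inv g = commutator G (g \<otimes> x \<otimes> inv g) (g \<otimes> y \<otimes> inv g)"
proof -
  have "(\<lambda>x. g \<otimes> x \<otimes> inv g) \<in> hom G G"
    using assms by (auto simp: hom_def m_assoc inv_solve_left)
  then interpret group_hom G G "\<lambda>x. g \<otimes> x \<otimes> inv g"
    by (simp add: group_hom_def group_hom_axioms_def is_group)
  show ?thesis using hom_commutator[OF assms(1,2)] .
qed

section \<open>Automorphisms and extension of homomorphisms\<close>

lemma (in group) conjugation_auto:
  assumes N: "N \<lhd> G" and g: "g \<in> carrier G"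
  shows "(\<lambda>x\<in>N. g \<otimes> x \<otimes> inv g) \<in> auto (G\<lparr>carrier := N\<rparr>)"
proof -
  interpret normal N G by (rule N)
  have closed: "k \<otimes> x \<otimes> inv k \<in> N" if "k \<in> carrier G" "x \<in> N" for k x
    using that inv_op_closed2 by simp
  have cancel: "inv k \<otimes> (k \<otimes> x) = x" "k \<otimes> (inv k \<otimes> x) = x" if "k \<in> carrier G" "x \<in> carrier G" for k x
    using that by (simp_all flip: m_assoc)
  have "bij_betw (\<lambda>x\<in>N. g \<otimes> x \<otimes> inv g) N N"
    by (rule bij_betw_byWitness[where f' = "\<lambda>x. inv g \<otimes> x \<otimes> inv (inv g)"])
      (use g closed[of g] closed[of "inv g"] mem_carrier in \<open>auto simp: m_assoc cancel\<close>)
  moreover have "g \<otimes> (x \<otimes> y) \<otimes> inv g = (g \<otimes> x \<otimes> inv g) \<otimes> (g \<otimes> y \<otimes> inv g)" if "x \<in> N" "y \<in> N" for x y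
    using that g mem_carrier by (simp add: m_assoc cancel)
  ultimately show ?thesis
    using closed[OF g] m_closed by (auto simp: auto_def Bij_def hom_def)
qed

lemma (in group) comm_AutoGroup_iff:
  "comm_group (AutoGroup G) \<longleftrightarrow>
    (\<forall>f \<in> auto G. \<forall>g \<in> auto G. \<forall>x \<in> carrier G. f (g x) = g (f x))"
proof -
  interpret A: group "AutoGroup G" by (rule AutoGroup)
  have carr: "carrier (AutoGroup G) = auto G"
    by (simp add: AutoGroup_def)
  have mult: "f \<otimes>\<^bsub>AutoGroup G\<^esub> g = compose (carrier G) f g" if "f \<in> auto G" "g \<in> auto G" for f g
    using that by (simp add: AutoGroup_def BijGroup_def auto_def)
  have "comm_group (AutoGroup G) \<longleftrightarrow>
      (\<forall>f \<in> auto G. \<forall>g \<in> auto G. compose (carrier G) f g = compose (carrier G) g f)"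
    using comm_groupE(4)[of "AutoGroup G"] A.group_comm_groupI by (auto simp: carr mult)
  also have "\<dots> \<longleftrightarrow> (\<forall>f \<in> auto G. \<forall>g \<in> auto G. \<forall>x \<in> carrier G. f (g x) = g (f x))"
    by (auto simp: compose_def fun_eq_iff restrict_def)
  finally show ?thesis .
qed

lemma (in group) hom_if_auto: "f \<in> auto G \<Longrightarrow> group_hom G G f"
  by (simp add: auto_def group_hom_def group_hom_axioms_def is_group)

text \<open>The images of \<open>x \<otimes> y\<close> and \<open>y \<otimes> x\<close> coincide and
  \<open>f\<close> is injective. Through this fact the invertibility of \<open>f\<close> becomes
  linear independence of the rows of its matrix modulo \<open>p\<close>.\<close>

lemma (in group) auto_center_imp:
  assumes f: "f \<in> auto G" and x: "x \<in> carrier G" and fx: "f x \<in> center G"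
  shows "x \<in> center G"
proof (rule centerI[OF x])
  interpret f: group_hom G G f using f by (rule hom_if_auto)
  fix y assume y: "y \<in> carrier G"
  have "f (x \<otimes> y) = f (y \<otimes> x)"
    using x y centerD[OF fx, of "f y"] by simp
  moreover have "inj_on f (carrier G)"
    using f by (simp add: auto_def Bij_def bij_betw_def)
  ultimately show "x \<otimes> y = y \<otimes> x"
    using x y by (meson inj_onD m_closed)
qed

text \<open>The universal property of the amalgamated product with a cyclic factor:
  \<open>h \<otimes> w [^] n\<close> goes to the product of \<open>\<phi> h\<close> and the
  \<open>n\<close>-th power of \<open>v\<close>. \<open>agree\<close> makes this independent of the
  factorization, \<open>conj\<close> makes it multiplicative.\<close>

lemma (in group) amalgamated_cyclic_hom_extension:
  assumes nH: "H \<lhd> G" and w: "w \<in> carrier G" and GH: "carrier G = H <#> generate G {w}"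
    and L: "group L" and v: "v \<in> carrier L"
    and \<phi>: "\<phi> \<in> hom (G\<lparr>carrier := H\<rparr>) L"
    and conj: "\<And>h. h \<in> H \<Longrightarrow> \<phi> (w \<otimes> h \<otimes> inv w) \<otimes>\<^bsub>L\<^esub> v = v \<otimes>\<^bsub>L\<^esub> \<phi> h"
    and agree: "\<And>n::int. w [^] n \<in> H \<Longrightarrow> \<phi> (w [^] n) = v [^]\<^bsub>L\<^esub> n"
  shows "\<exists>F \<in> hom G L. (\<forall>h \<in> H. F h = \<phi> h) \<and> F w = v"
proof -
  interpret L: group L by (rule L)
  interpret nH: normal H G by (rule nH)
  have HG: "h \<in> carrier G" if "h \<in> H" for h using that nH.mem_carrier by blast
  have \<phi>L: "\<phi> h \<in> carrier L" if "h \<in> H" for h using \<phi> that by (auto simp: hom_def)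
  have \<phi>m: "\<phi> (h \<otimes> k) = \<phi> h \<otimes>\<^bsub>L\<^esub> \<phi> k" if "h \<in> H" "k \<in> H" for h k
    using \<phi> that by (auto simp: hom_def)
  have conj_mem: "g \<otimes> h \<otimes> inv g \<in> H" if "g \<in> carrier G" "h \<in> H" for g h
    using that nH.inv_op_closed2 by simp
  have conj_nat: "\<phi> (w [^] n \<otimes> h \<otimes> inv (w [^] n)) \<otimes>\<^bsub>L\<^esub> v [^]\<^bsub>L\<^esub> n = v [^]\<^bsub>L\<^esub> n \<otimes>\<^bsub>L\<^esub> \<phi> h"
    if "h \<in> H" for h and n :: nat
    using that
  proof (induction n arbitrary: h)
    case 0 then show ?case by (simp add: \<phi>L HG)
  next
    case (Suc n)
    let ?k = "w \<otimes> h \<otimes> inv w"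
    have k: "?k \<in> H" using conj_mem w Suc.prems by simp
    have e: "w [^] Suc n \<otimes> h \<otimes> inv (w [^] Suc n) = w [^] n \<otimes> ?k \<otimes> inv (w [^] n)"
      using w HG[OF Suc.prems] by (simp add: m_assoc inv_mult_group)
    have "\<phi> (w [^] Suc n \<otimes> h \<otimes> inv (w [^] Suc n)) \<otimes>\<^bsub>L\<^esub> v [^]\<^bsub>L\<^esub> Suc n
        = \<phi> (w [^] n \<otimes> ?k \<otimes> inv (w [^] n)) \<otimes>\<^bsub>L\<^esub> v [^]\<^bsub>L\<^esub> n \<otimes>\<^bsub>L\<^esub> v"
      unfolding e using k w v by (simp add: L.m_assoc \<phi>L conj_mem)
    also have "\<dots> = v [^]\<^bsub>L\<^esub> n \<otimes>\<^bsub>L\<^esub> (\<phi> ?k \<otimes>\<^bsub>L\<^esub> v)"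
      using Suc.IH[OF k] k v by (simp add: L.m_assoc \<phi>L)
    also have "\<dots> = v [^]\<^bsub>L\<^esub> Suc n \<otimes>\<^bsub>L\<^esub> \<phi> h"
      using conj[OF Suc.prems] v Suc.prems by (simp add: L.m_assoc \<phi>L)
    finally show ?case .
  qed
  have conj_int: "\<phi> (w [^] n \<otimes> h \<otimes> inv (w [^] n)) \<otimes>\<^bsub>L\<^esub> v [^]\<^bsub>L\<^esub> n = v [^]\<^bsub>L\<^esub> n \<otimes>\<^bsub>L\<^esub> \<phi> h"
    if h: "h \<in> H" for h and n :: int
  proof (cases n rule: int_cases2)
    case (nonneg k) then show ?thesis using conj_nat[OF h, of k] by (simp add: int_pow_int)
  next
    case (nonpos k)
    let ?k = "inv (w [^] k) \<otimes> h \<otimes> w [^] k"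
    have k: "?k \<in> H" using conj_mem[of "inv (w [^] k)"] w h by simp
    have "w [^] k \<otimes> ?k \<otimes> inv (w [^] k) = h"
      using w HG[OF h] by (simp add: m_assoc inv_solve_left) (simp add: m_assoc[symmetric])
    then have "\<phi> h \<otimes>\<^bsub>L\<^esub> v [^]\<^bsub>L\<^esub> k = v [^]\<^bsub>L\<^esub> k \<otimes>\<^bsub>L\<^esub> \<phi> ?k"
      using conj_nat[OF k, of k] by simp
    then have "inv\<^bsub>L\<^esub> (v [^]\<^bsub>L\<^esub> k) \<otimes>\<^bsub>L\<^esub> \<phi> h = \<phi> ?k \<otimes>\<^bsub>L\<^esub> inv\<^bsub>L\<^esub> (v [^]\<^bsub>L\<^esub> k)"
      using v k h \<phi>L by (metis L.inv_closed L.inv_solve_left' L.inv_solve_right' L.m_assoc L.m_closed L.nat_pow_closed)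
    then show ?thesis
      using nonpos w v by (simp add: int_pow_neg_int L.int_pow_neg_int)
  qed
  \<comment> \<open>A factorization is not unique if \<open>H\<close> contains nontrivial powers of
    \<open>w\<close>, so one is chosen. Two of them differ by a power of \<open>w\<close> that lies
    in \<open>H\<close>, which is what \<open>agree\<close> controls.\<close>
  define F where "F g = (let (h, n) = (SOME (h, n :: int). h \<in> H \<and> g = h \<otimes> w [^] n) in \<phi> h \<otimes>\<^bsub>L\<^esub> v [^]\<^bsub>L\<^esub> n)" for g
  have F: "F (h \<otimes> w [^] n) = \<phi> h \<otimes>\<^bsub>L\<^esub> v [^]\<^bsub>L\<^esub> n" if h: "h \<in> H" for h and n :: int
  proof -
    let ?Q = "\<lambda>(k, m :: int). k \<in> H \<and> h \<otimes> w [^] n = k \<otimes> w [^] m"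
    obtain k m where km: "(SOME q. ?Q q) = (k, m)" by fastforce
    have "?Q (SOME q. ?Q q)" by (rule someI[of ?Q "(h, n)"]) (simp add: h)
    then have k: "k \<in> H" and eq: "h \<otimes> w [^] n = k \<otimes> w [^] m" by (auto simp: km)
    have "w [^] (n - m) = inv h \<otimes> k"
      using eq w HG[OF h] HG[OF k]
      by (metis int_pow_closed int_pow_diff inv_solve_left inv_solve_right' m_assoc m_closed inv_closed)
    then have wH: "w [^] (n - m) \<in> H" and k_eq: "k = h \<otimes> w [^] (n - m)"
      using h k HG by (simp_all add: m_assoc[symmetric])
    have "\<phi> k \<otimes>\<^bsub>L\<^esub> v [^]\<^bsub>L\<^esub> m = \<phi> h \<otimes>\<^bsub>L\<^esub> (v [^]\<^bsub>L\<^esub> (n - m) \<otimes>\<^bsub>L\<^esub> v [^]\<^bsub>L\<^esub> m)"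
      unfolding k_eq using \<phi>m[OF h wH] agree[OF wH] h v by (simp add: L.m_assoc \<phi>L)
    also have "v [^]\<^bsub>L\<^esub> (n - m) \<otimes>\<^bsub>L\<^esub> v [^]\<^bsub>L\<^esub> m = v [^]\<^bsub>L\<^esub> n"
      using L.int_pow_mult[OF v, of "n - m" m] by simp
    finally show ?thesis by (simp add: F_def km)
  qed
  have form: "\<exists>h n. h \<in> H \<and> g = h \<otimes> w [^] (n::int)" if "g \<in> carrier G" for g
    using that unfolding GH generate_pow[OF w] set_mult_def by auto
  have "F \<in> hom G L"
  proof (rule homI)
    fix g assume "g \<in> carrier G"
    then obtain h n where "h \<in> H" "g = h \<otimes> w [^] (n::int)" using form by blast
    then show "F g \<in> carrier L" using F v \<phi>L by simp
  next
    fix g g' assume "g \<in> carrier G" "g' \<in> carrier G"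
    then obtain h n h' n' where h: "h \<in> H" and g: "g = h \<otimes> w [^] (n::int)"
      and h': "h' \<in> H" and g': "g' = h' \<otimes> w [^] (n'::int)" using form by meson
    let ?k = "w [^] n \<otimes> h' \<otimes> inv (w [^] n)"
    have k: "?k \<in> H" using conj_mem h' w by simp
    have "g \<otimes> g' = (h \<otimes> ?k) \<otimes> w [^] (n + n')"
      using w HG[OF h] HG[OF h'] by (simp add: g g' int_pow_mult m_assoc inv_solve_left)
    then have "F (g \<otimes> g') = \<phi> h \<otimes>\<^bsub>L\<^esub> \<phi> ?k \<otimes>\<^bsub>L\<^esub> (v [^]\<^bsub>L\<^esub> n \<otimes>\<^bsub>L\<^esub> v [^]\<^bsub>L\<^esub> n')"
      using h k v F[of "h \<otimes> ?k" "n + n'"] by (simp add: \<phi>m L.int_pow_mult)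
    also have "\<dots> = \<phi> h \<otimes>\<^bsub>L\<^esub> (\<phi> ?k \<otimes>\<^bsub>L\<^esub> v [^]\<^bsub>L\<^esub> n) \<otimes>\<^bsub>L\<^esub> v [^]\<^bsub>L\<^esub> n'"
      using h k v by (simp add: L.m_assoc \<phi>L)
    also have "\<dots> = F g \<otimes>\<^bsub>L\<^esub> F g'"
      unfolding conj_int[OF h'] using h h' v by (simp add: g g' F L.m_assoc \<phi>L)
    finally show "F (g \<otimes> g') = F g \<otimes>\<^bsub>L\<^esub> F g'" .
  qed
  moreover have "F h = \<phi> h" if "h \<in> H" for h
    using F[OF that, of 0] HG[OF that] \<phi>L[OF that] by simp
  moreover have "F w = v"
    using F[OF nH.one_closed, of 1] agree[of 0] nH.one_closed w v by simp
  ultimately show ?thesis by blast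
qed

section \<open>Evaluation of words and von Dyck's theorem\<close>

primrec term_eval :: "('g, 'm) monoid_scheme \<Rightarrow> ('x \<Rightarrow> 'g) \<Rightarrow> 'x gterm \<Rightarrow> 'g" where
  "term_eval G x (Gen i) = x i"
| "term_eval G x Unit = \<one>\<^bsub>G\<^esub>"
| "term_eval G x (Mult s t) = term_eval G x s \<otimes>\<^bsub>G\<^esub> term_eval G x t"
| "term_eval G x (Inv s) = inv\<^bsub>G\<^esub> (term_eval G x s)"

lemma (in group) term_eval_in_subgroup:
  assumes "subgroup H G" and "\<And>i. x i \<in> H"
  shows "term_eval G x s \<in> H"
  using assms by (induction s) (auto simp: subgroup.one_closed subgroup.m_closed subgroup.m_inv_closed)

lemma (in group) term_eval_closed:
  assumes "\<And>i. x i \<in> carrier G"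
  shows "term_eval G x s \<in> carrier G"
  using assms subgroup_self by (rule term_eval_in_subgroup[rotated])

lemma (in group) term_eval_eq_if_pres_eq:
  assumes x: "\<And>i. x i \<in> carrier G"
    and R: "\<And>s t. (s, t) \<in> R \<Longrightarrow> term_eval G x s = term_eval G x t"
    and "pres_eq R s t"
  shows "term_eval G x s = term_eval G x t"
  using assms(3)
  by induction (auto simp: R m_assoc term_eval_closed[of x, OF x])

text \<open>The given isomorphism maps the class of a word to the value of the word, by induction on
  words. Hence equations between elements of \<open>H\<close> are exactly the derivable equations
  between words, and anything invariant under \<open>pres_eq\<close> becomes a tool for telling
  elements apart.\<close>

lemma (in group) presented_by_term_eval:
  assumes H: "subgroup H G" and pres: "presented_by (G\<lparr>carrier := H\<rparr>) R x"
  shows "x i \<in> H" and "range (term_eval G x) = H"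
    and "term_eval G x s = term_eval G x t \<longleftrightarrow> pres_eq R s t"
proof -
  let ?P = "presented_group R" and ?K = "G\<lparr>carrier := H\<rparr>"
  from pres obtain h where h: "h \<in> iso ?P ?K" and hx: "\<And>i. h (pres_class R (Gen i)) = x i"
    by (auto simp: presented_by_def)
  have carrP: "carrier ?P = range (pres_class R)"
    by (simp add: presented_group_def)
  have bij: "bij_betw h (carrier ?P) H" and hom: "h \<in> hom ?P ?K"
    using h by (auto simp: iso_def)
  have K: "group ?K" by (rule subgroup_imp_group[OF H])
  interpret gh: group_hom ?P ?K h
    using group_presented_group K hom by (simp add: group_hom_def group_hom_axioms_def)
  have mem: "h (pres_class R s) \<in> H" for s
    using bij by (auto simp: bij_betw_def carrP)
  have mult: "h (pres_class R (Mult s t)) = h (pres_class R s) \<otimes> h (pres_class R t)" for s t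
    using gh.hom_mult[of "pres_class R s" "pres_class R t"] by (simp add: carrP)
  have one: "h (pres_class R Unit) = \<one>"
    using gh.hom_one by (simp add: presented_group_def)
  have inv: "h (pres_class R (Inv s)) = inv (h (pres_class R s))" for s
  proof -
    have "h (pres_class R (Inv s)) \<otimes> h (pres_class R s) = \<one>"
      unfolding mult[symmetric] one[symmetric]
      by (rule arg_cong[of _ _ h]) (simp add: pres_class_eq_iff pres_eq.l_inv)
    then show ?thesis
      using mem H by (metis inv_equality subgroup.mem_carrier)
  qed
  have ev: "term_eval G x s = h (pres_class R s)" for s
    by (induction s) (simp_all add: hx mult one inv)
  show "x i \<in> H"
    using mem hx by metis
  show "range (term_eval G x) = H"
    using bij by (auto simp: bij_betw_def carrP ev image_image)
  show "term_eval G x s = term_eval G x t \<longleftrightarrow> pres_eq R s t"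
    using bij unfolding ev pres_class_eq_iff[symmetric]
    by (metis bij_betw_def carrP inj_on_eq_iff rangeI)
qed

text \<open>Each element is spelled by some chosen word, which is then evaluated at
  \<open>y\<close>. The choice is harmless: two words for one element are related by
  \<open>pres_eq\<close>, and \<open>L\<close> satisfies the relations.\<close>

lemma (in group) von_dyck:
  assumes H: "subgroup H G" and pres: "presented_by (G\<lparr>carrier := H\<rparr>) R x"
    and L: "group L" and y: "\<And>i. y i \<in> carrier L"
    and R: "\<And>s t. (s, t) \<in> R \<Longrightarrow> term_eval L y s = term_eval L y t"
  shows "\<exists>\<phi> \<in> hom (G\<lparr>carrier := H\<rparr>) L. \<forall>i. \<phi> (x i) = y i"
proof -
  interpret L: group L by (rule L)
  note facts = presented_by_term_eval[OF H pres]
  define \<phi> where "\<phi> h = term_eval L y (SOME s. term_eval G x s = h)" for h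
  have \<phi>: "\<phi> (term_eval G x s) = term_eval L y s" for s
  proof -
    have "term_eval G x (SOME t. term_eval G x t = term_eval G x s) = term_eval G x s"
      by (rule someI) (rule HOL.refl)
    then show ?thesis
      unfolding \<phi>_def facts(3) using L.term_eval_eq_if_pres_eq[OF y R] by blast
  qed
  have "\<phi> \<in> hom (G\<lparr>carrier := H\<rparr>) L"
  proof (rule homI)
    fix h assume "h \<in> carrier (G\<lparr>carrier := H\<rparr>)"
    then obtain s where "h = term_eval G x s" using facts(2) by auto
    then show "\<phi> h \<in> carrier L" using \<phi> L.term_eval_closed[OF y] by simp
  next
    fix h k assume "h \<in> carrier (G\<lparr>carrier := H\<rparr>)" "k \<in> carrier (G\<lparr>carrier := H\<rparr>)"
    then obtain s t where "h = term_eval G x s" "k = term_eval G x t" using facts(2) by auto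
    then show "\<phi> (h \<otimes>\<^bsub>G\<lparr>carrier := H\<rparr>\<^esub> k) = \<phi> h \<otimes>\<^bsub>L\<^esub> \<phi> k"
      using \<phi>[of "Mult s t"] \<phi> by simp
  qed
  moreover have "\<phi> (x i) = y i" for i
    using \<phi>[of "Gen i"] by simp
  ultimately show ?thesis by blast
qed

section \<open>Invariants of words\<close>

primrec expo :: "'x gterm \<Rightarrow> 'x \<Rightarrow> int" where
  "expo (Gen j) i = (if i = j then 1 else 0)"
| "expo Unit i = 0"
| "expo (Mult s t) i = expo s i + expo t i"
| "expo (Inv s) i = - expo s i"

text \<open>
  For a linear functional \<open>l\<close> on the commutators, \<open>(expo s, zeta p l s)\<close> is the value of \<open>s\<close> in the group
  of pairs \<open>(u, z)\<close>, \<open>u\<close> modulo \<open>p\<close> and \<open>z\<close> modulo \<open>p\<^sup>2\<close>, with product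
  \<open>(u + v, z + z' + p * form l u v)\<close>. Taking \<open>z\<close> modulo \<open>p\<^sup>2\<close> lets a generator have a nontrivial
  \<open>p\<close>-th power, so that all relations of \<open>H\<close> hold.
\<close>

type_synonym functional = "H_gen \<Rightarrow> H_gen \<Rightarrow> int"

definition form :: "functional \<Rightarrow> (H_gen \<Rightarrow> int) \<Rightarrow> (H_gen \<Rightarrow> int) \<Rightarrow> int" where
  "form l u v = l A B * u A * v B + l A C * u A * v C + l A D * u A * v D
     + l B C * u B * v C + l B D * u B * v D + l C D * u C * v D"

text \<open>These are the values of \<open>l\<close> on \<open>[a,c]\<close>,
  \<open>[a,bcd]\<close>, \<open>[b,cd]\<close> and \<open>[b,d]\<close>. They are dictated by the
  relations: \<open>p\<close> times the height of a generator has to equal the \<open>zeta\<close>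
  of the commutator to which its \<open>p\<close>-th power is equated.\<close>

primrec gen_height :: "functional \<Rightarrow> H_gen \<Rightarrow> int" where
  "gen_height l A = l A C"
| "gen_height l B = l A B + l A C + l A D"
| "gen_height l C = l B C + l B D"
| "gen_height l D = l B D"

primrec zeta :: "nat \<Rightarrow> functional \<Rightarrow> H_gen gterm \<Rightarrow> int" where
  "zeta p l (Gen i) = gen_height l i"
| "zeta p l Unit = 0"
| "zeta p l (Mult s t) = zeta p l s + zeta p l t + int p * form l (expo s) (expo t)"
| "zeta p l (Inv s) = - zeta p l s + int p * form l (expo s) (expo s)"

lemma expo_Pow: "expo (Pow s n) i = int n * expo s i"
  by (induction n) (simp_all add: algebra_simps)

lemma expo_Comm: "expo (Comm s t) i = 0"
  by (simp add: Comm_def)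

lemma zeta_Comm: "zeta p l (Comm s t) = int p * (form l (expo s) (expo t) - form l (expo t) (expo s))"
  by (simp add: Comm_def form_def algebra_simps)

text \<open>In general a term with the binomial coefficient of \<open>n\<close> over 2 would appear.
  It vanishes for a single generator, since \<open>form\<close> contains only mixed products, and
  for words with zero exponents.\<close>

lemma zeta_Pow:
  assumes "form l (expo s) (expo s) = 0"
  shows "zeta p l (Pow s n) = int n * zeta p l s"
proof (induction n)
  case (Suc n)
  have "form l (expo (Pow s n)) (expo s) = int n * form l (expo s) (expo s)"
    by (simp add: form_def expo_Pow algebra_simps)
  then show ?case using Suc assms by (simp add: algebra_simps)
qed simp

lemma form_cong:
  assumes "\<And>i. [u i = u' i] (mod m)" "\<And>i. [v i = v' i] (mod m)"
  shows "[form l u v = form l u' v'] (mod m)"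
  unfolding form_def by (intro cong_add cong_mult assms cong_refl)

text \<open>Commutators have zero exponents, so double commutators have both invariants zero. In the
  power relations \<open>gen_height\<close> balances \<open>zeta\<close> exactly, whereas the
  exponents \<open>p\<close> and \<open>0\<close> agree only modulo \<open>p\<close>.\<close>

lemma H_relations_invariants:
  assumes "(s, t) \<in> H_relations p"
  shows "[expo s i = expo t i] (mod int p)" and "zeta p l s = zeta p l t"
proof -
  show "[expo s i = expo t i] (mod int p)"
    using assms by (auto simp: H_relations_def expo_Comm expo_Pow cong_def)
  show "zeta p l s = zeta p l t"
    using assms
    by (auto simp: H_relations_def zeta_Comm) (auto simp: zeta_Comm zeta_Pow expo_Comm form_def algebra_simps)
qed

text \<open>Exponents are controlled only modulo \<open>p\<close>, and so is \<open>form\<close>;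
  the factor \<open>int p\<close> in front of it lifts this to a congruence modulo
  \<open>int p * int p\<close>. The two invariants therefore have to be carried through one
  induction.\<close>

lemma pres_eq_invariants:
  assumes "pres_eq (H_relations p) s t"
  shows "(\<forall>i. [expo s i = expo t i] (mod int p)) \<and> [zeta p l s = zeta p l t] (mod int p * int p)"
  using assms
proof induction
  case (rel s t)
  then show ?case using H_relations_invariants by (metis cong_refl)
next
  case (sym s t) then show ?case by (auto intro: cong_sym)
next
  case (trans s t u) then show ?case by (meson cong_trans)
next
  case (cong_Mult s s' t t')
  then have "[form l (expo s) (expo t) = form l (expo s') (expo t')] (mod int p)"
    by (intro form_cong) auto
  then have f: "[int p * form l (expo s) (expo t) = int p * form l (expo s') (expo t')] (mod int p * int p)"
    by (rule cong_cmult_leftI)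
  have "[expo s i + expo t i = expo s' i + expo t' i] (mod int p)" for i
    using cong_Mult by (intro cong_add) auto
  moreover have "[zeta p l s + zeta p l t + int p * form l (expo s) (expo t)
      = zeta p l s' + zeta p l t' + int p * form l (expo s') (expo t')] (mod int p * int p)"
    using cong_Mult f by (intro cong_add) auto
  ultimately show ?case by simp
next
  case (cong_Inv s s')
  then have "[form l (expo s) (expo s) = form l (expo s') (expo s')] (mod int p)"
    by (intro form_cong) auto
  then have f: "[int p * form l (expo s) (expo s) = int p * form l (expo s') (expo s')] (mod int p * int p)"
    by (rule cong_cmult_leftI)
  have "[- zeta p l s + int p * form l (expo s) (expo s)
      = - zeta p l s' + int p * form l (expo s') (expo s')] (mod int p * int p)"
    using cong_Inv f by (intro cong_add) (auto simp: cong_minus_minus_iff)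
  then show ?case using cong_Inv by (simp add: cong_minus_minus_iff)
next
  case (assoc s t u)
  then show ?case by (simp add: form_def algebra_simps)
next
  case (l_one s)
  then show ?case by (simp add: form_def)
next
  case (l_inv s)
  then show ?case by (simp add: form_def algebra_simps)
qed simp

definition IPow :: "'x gterm \<Rightarrow> int \<Rightarrow> 'x gterm" where
  "IPow s k = (if k < 0 then Inv (Pow s (nat (- k))) else Pow s (nat k))"

lemma expo_IPow: "expo (IPow s k) i = k * expo s i"
  by (simp add: IPow_def expo_Pow)

lemma zeta_IPow:
  assumes "\<And>i. expo s i = 0"
  shows "zeta p l (IPow s k) = k * zeta p l s"
proof -
  have form0: "form l (expo s) (expo s) = 0" "form l (expo (Pow s n)) (expo (Pow s n)) = 0" for n
    by (simp_all add: form_def expo_Pow assms)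
  show ?thesis
    by (simp add: IPow_def zeta_Pow[OF form0(1)] form0(2))
qed

lemma (in group) term_eval_Pow: "term_eval G x (Pow s n) = term_eval G x s [^] n"
  by (induction n) simp_all

lemma (in group) term_eval_IPow: "term_eval G x (IPow s k) = term_eval G x s [^] k"
  by (auto simp: IPow_def term_eval_Pow int_pow_def2 simp del: pow_nat)

lemma (in group) term_eval_Comm:
  "term_eval G x (Comm s t) = commutator G (term_eval G x s) (term_eval G x t)"
  by (simp add: Comm_def commutator_def)

definition gen_word :: "(H_gen \<Rightarrow> int) \<Rightarrow> H_gen gterm" where
  "gen_word u = Mult (IPow (Gen A) (u A)) (Mult (IPow (Gen B) (u B)) (Mult (IPow (Gen C) (u C)) (IPow (Gen D) (u D))))"

definition comm_word :: "int \<Rightarrow> int \<Rightarrow> int \<Rightarrow> int \<Rightarrow> int \<Rightarrow> int \<Rightarrow> H_gen gterm" where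
  "comm_word z1 z2 z3 z4 z5 z6 =
    Mult (IPow (Comm (Gen A) (Gen B)) z1) (Mult (IPow (Comm (Gen A) (Gen C)) z2) (Mult (IPow (Comm (Gen A) (Gen D)) z3)
     (Mult (IPow (Comm (Gen B) (Gen C)) z4) (Mult (IPow (Comm (Gen B) (Gen D)) z5) (IPow (Comm (Gen C) (Gen D)) z6)))))"

lemma expo_gen_word: "expo (gen_word u) i = u i"
  by (cases i) (simp_all add: gen_word_def expo_IPow)

lemma expo_comm_word: "expo (comm_word z1 z2 z3 z4 z5 z6) i = 0"
  by (simp add: comm_word_def expo_IPow expo_Comm)

lemma zeta_comm_word:
  "zeta p l (comm_word z1 z2 z3 z4 z5 z6) =
     int p * (z1 * l A B + z2 * l A C + z3 * l A D + z4 * l B C + z5 * l B D + z6 * l C D)"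
  by (simp add: comm_word_def zeta_IPow expo_Comm zeta_Comm expo_IPow form_def algebra_simps)

text \<open>This is the independence of the six commutators. Taking for \<open>l\<close> each of the
  six coordinate functionals, \<open>zeta\<close> equals \<open>int p\<close> times one exponent and
  is divisible by \<open>int p * int p\<close>.\<close>

lemma comm_word_trivial:
  assumes "p > 0" and "pres_eq (H_relations p) (comm_word z1 z2 z3 z4 z5 z6) Unit"
  shows "int p dvd z1" "int p dvd z2" "int p dvd z3" "int p dvd z4" "int p dvd z5" "int p dvd z6"
proof -
  have *: "int p dvd z1 * l A B + z2 * l A C + z3 * l A D + z4 * l B C + z5 * l B D + z6 * l C D" for l
  proof -
    have "[zeta p l (comm_word z1 z2 z3 z4 z5 z6) = 0] (mod int p * int p)"
      using pres_eq_invariants[OF assms(2), of l] by simp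
    then show ?thesis using \<open>p > 0\<close> by (simp add: zeta_comm_word cong_0_iff)
  qed
  show "int p dvd z1" using *[of "\<lambda>i j. if (i, j) = (A, B) then 1 else 0"] by simp
  show "int p dvd z2" using *[of "\<lambda>i j. if (i, j) = (A, C) then 1 else 0"] by simp
  show "int p dvd z3" using *[of "\<lambda>i j. if (i, j) = (A, D) then 1 else 0"] by simp
  show "int p dvd z4" using *[of "\<lambda>i j. if (i, j) = (B, C) then 1 else 0"] by simp
  show "int p dvd z5" using *[of "\<lambda>i j. if (i, j) = (B, D) then 1 else 0"] by simp
  show "int p dvd z6" using *[of "\<lambda>i j. if (i, j) = (C, D) then 1 else 0"] by simp
qed

section \<open>Linear algebra modulo a prime\<close>

text \<open>
  The rows \<open>(\<alpha>, n1), (\<beta>, n2), (\<gamma>, n3), (\<delta>, n4), (\<omega>, m)\<close> are the exponent vectors of the images of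
  \<open>a, b, c, d, w\<close> under an automorphism, the last entry being the exponent of \<open>w\<close>. The hypotheses are
  coordinates of the images of \<open>[w,b] = [w,c] = [w,d] = 1\<close>, of \<open>[a,b] = w\<^sup>j\<close> with \<open>p\<^sup>2\<close> dividing
  \<open>j\<close>, of \<open>[b,d] = [w,a]\<close>, and of the four \<open>p\<close>-th power relations.
\<close>

lemma rigid_solution:
  fixes q :: int and \<alpha> \<beta> \<gamma> \<delta> \<omega> :: "H_gen \<Rightarrow> int" and m n1 n2 n3 n4 k1 k2 k3 k4 :: int
  assumes q: "Factorial_Ring.prime q"
    and n: "q dvd n1" "q dvd n2" "q dvd n3" "q dvd n4"
    and independent: "\<And>r1 r2 r3 r4 r5.
      (\<And>i. q dvd r1 * \<alpha> i + r2 * \<beta> i + r3 * \<gamma> i + r4 * \<delta> i + r5 * \<omega> i) \<Longrightarrow>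
      q dvd r1 * n1 + r2 * n2 + r3 * n3 + r4 * n4 + r5 * m \<Longrightarrow>
      q dvd r1 \<and> q dvd r2 \<and> q dvd r3 \<and> q dvd r4 \<and> q dvd r5"
    and wb: "q dvd \<omega> A * \<beta> B - \<omega> B * \<beta> A" "q dvd \<omega> A * \<beta> C - \<omega> C * \<beta> A" "q dvd \<omega> A * \<beta> D - \<omega> D * \<beta> A"
      "q dvd \<omega> B * \<beta> C - \<omega> C * \<beta> B" "q dvd \<omega> B * \<beta> D - \<omega> D * \<beta> B + m * \<beta> A - n2 * \<omega> A" "q dvd \<omega> C * \<beta> D - \<omega> D * \<beta> C"
    and wc: "q dvd \<omega> A * \<gamma> B - \<omega> B * \<gamma> A" "q dvd \<omega> A * \<gamma> C - \<omega> C * \<gamma> A" "q dvd \<omega> A * \<gamma> D - \<omega> D * \<gamma> A"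
      "q dvd \<omega> B * \<gamma> C - \<omega> C * \<gamma> B" "q dvd \<omega> B * \<gamma> D - \<omega> D * \<gamma> B + m * \<gamma> A - n3 * \<omega> A" "q dvd \<omega> C * \<gamma> D - \<omega> D * \<gamma> C"
    and wd: "q dvd \<omega> A * \<delta> B - \<omega> B * \<delta> A" "q dvd \<omega> A * \<delta> C - \<omega> C * \<delta> A" "q dvd \<omega> A * \<delta> D - \<omega> D * \<delta> A"
      "q dvd \<omega> B * \<delta> D - \<omega> D * \<delta> B + m * \<delta> A - n4 * \<omega> A"
    and ab: "q dvd \<alpha> A * \<beta> B - \<alpha> B * \<beta> A - m" "q dvd \<alpha> A * \<beta> C - \<alpha> C * \<beta> A" "q dvd \<alpha> A * \<beta> D - \<alpha> D * \<beta> A"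
      "q dvd \<alpha> B * \<beta> C - \<alpha> C * \<beta> B" "q dvd \<alpha> B * \<beta> D - \<alpha> D * \<beta> B + n1 * \<beta> A - n2 * \<alpha> A"
    and bd: "q dvd \<beta> B * \<delta> C - \<beta> C * \<delta> B - (\<omega> B * \<alpha> C - \<omega> C * \<alpha> B)"
      "q dvd \<beta> B * \<delta> D - \<beta> D * \<delta> B + n2 * \<delta> A - n4 * \<beta> A - (\<omega> B * \<alpha> D - \<omega> D * \<alpha> B + m * \<alpha> A - n1 * \<omega> A)"
    and pa: "q dvd \<alpha> A * \<gamma> C - \<alpha> C * \<gamma> A - (\<alpha> A + \<alpha> B)"
      "q dvd \<alpha> A * \<gamma> D - \<alpha> D * \<gamma> A - \<alpha> B"
      "q dvd \<alpha> B * \<gamma> D - \<alpha> D * \<gamma> B + n1 * \<gamma> A - n3 * \<alpha> A - (\<alpha> C + \<alpha> D)"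
    and pb: "q dvd \<alpha> A * (\<beta> C + \<gamma> C + \<delta> C) - \<alpha> C * (\<beta> A + \<gamma> A + \<delta> A) - (\<beta> A + \<beta> B)"
    and pc: "q dvd \<beta> A * (\<gamma> C + \<delta> C) - \<beta> C * (\<gamma> A + \<delta> A) - (\<gamma> A + \<gamma> B)"
    and pd: "q dvd \<beta> A * \<delta> D - \<beta> D * \<delta> A - \<delta> B"
      "q dvd \<beta> B * \<delta> D - \<beta> D * \<delta> B + n2 * \<delta> A - n4 * \<beta> A - (\<delta> C + \<delta> D)"
  shows "(\<forall>i. q dvd \<alpha> i - case_H_gen 1 0 0 0 i) \<and> (\<forall>i. q dvd \<beta> i - case_H_gen 0 1 0 0 i) \<and>
      (\<forall>i. q dvd \<gamma> i - case_H_gen 0 0 1 0 i) \<and> (\<forall>i. q dvd \<delta> i - case_H_gen 0 0 0 1 i) \<and>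
      (\<forall>i. q dvd \<omega> i) \<and> q dvd m - 1"
proof -
  have mult: "q dvd x \<or> q dvd y" if "q dvd x * y" for x y
    using prime_dvd_multD[OF q that] .
  have not1: "\<not> q dvd 1" using q not_prime_unit by blast
  \<comment> \<open>If \<open>\<omega> i\<close> were invertible, \<open>\<beta>\<close> and
    \<open>\<gamma>\<close> would both be multiples of \<open>\<omega>\<close> modulo
    \<open>q\<close>. Then \<open>\<gamma> i * \<beta> - \<beta> i * \<gamma>\<close> is a vanishing
    row combination, so \<open>\<beta> i\<close> vanishes by independence, and with it the whole row
    \<open>\<beta>\<close>, a contradiction.\<close>
  have dependent: "q dvd \<omega> i"
    if wb: "\<And>j. q dvd \<omega> i * \<beta> j - \<omega> j * \<beta> i" and wc: "\<And>j. q dvd \<omega> i * \<gamma> j - \<omega> j * \<gamma> i" for i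
  proof (rule ccontr)
    assume w: "\<not> q dvd \<omega> i"
    have "q dvd \<gamma> i * \<beta> j - \<beta> i * \<gamma> j" for j
    proof -
      have "q dvd \<gamma> i * (\<omega> i * \<beta> j - \<omega> j * \<beta> i) - \<beta> i * (\<omega> i * \<gamma> j - \<omega> j * \<gamma> i)"
        by (rule dvd_diff[OF dvd_mult[OF wb] dvd_mult[OF wc]])
      also have "\<dots> = \<omega> i * (\<gamma> i * \<beta> j - \<beta> i * \<gamma> j)" by (simp add: algebra_simps)
      finally show ?thesis using mult w by blast
    qed
    then have "q dvd \<beta> i"
      using independent[of 0 "\<gamma> i" "- \<beta> i" 0 0] n by (simp add: dvd_diff)
    then have "q dvd \<omega> i * \<beta> j" for j
      using wb[of j] by (simp add: dvd_diff_left_iff)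
    then have "q dvd \<beta> j" for j
      using mult w by blast
    then show False
      using independent[of 0 1 0 0 0] n not1 by simp
  qed
  have w1: "q dvd \<omega> A"
  proof (rule dependent)
    show "q dvd \<omega> A * \<beta> j - \<omega> j * \<beta> A" "q dvd \<omega> A * \<gamma> j - \<omega> j * \<gamma> A" for j
      using wb wc by (cases j; simp)+
  qed
  \<comment> \<open>If \<open>v A\<close> were invertible, the minors would force
    \<open>\<omega>\<close> to vanish, and the last equation would reduce to \<open>m * v A\<close>.
    Then \<open>m\<close> vanishes too, so the row of \<open>w\<close> is zero, against
    independence. The rows \<open>\<beta>\<close>, \<open>\<gamma>\<close>, \<open>\<delta>\<close>
    are the instances.\<close>
  have w_or_y1: "q dvd v A"
    if "q dvd \<omega> A * v B - \<omega> B * v A" "q dvd \<omega> A * v C - \<omega> C * v A" "q dvd \<omega> A * v D - \<omega> D * v A"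
      "q dvd \<omega> B * v D - \<omega> D * v B + m * v A - l * \<omega> A" for v l
  proof (rule ccontr)
    assume v: "\<not> q dvd v A"
    have "q dvd \<omega> B" "q dvd \<omega> C" "q dvd \<omega> D"
      using that(1-3) w1 v mult by (auto simp: dvd_diff_right_iff)
    then have w: "q dvd \<omega> i" for i using w1 by (cases i) simp_all
    then have "q dvd m * v A"
      using that(4) by (simp add: dvd_add_left_iff dvd_add_right_iff dvd_diff_left_iff dvd_diff_right_iff)
    then have "q dvd m" using mult v by blast
    then show False
      using independent[of 0 0 0 0 1] w not1 by simp
  qed
  have b1: "q dvd \<beta> A" and c1: "q dvd \<gamma> A" and d1: "q dvd \<delta> A"
    using w_or_y1[of \<beta>, OF wb(1,2,3,5)] w_or_y1[of \<gamma>, OF wc(1,2,3,5)] w_or_y1[of \<delta>, OF wd] by blast+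
  note red = dvd_add_left_iff dvd_add_right_iff dvd_diff_left_iff dvd_diff_right_iff
  \<comment> \<open>With the first entries zero modulo \<open>q\<close>, the terms stemming from
    \<open>[w,a] = [b,d]\<close> drop out and the \<open>[b,d]\<close>-coordinates become plain
    minors, so that \<open>dependent\<close> reaches every entry of \<open>\<omega>\<close>.\<close>
  have wb5: "q dvd \<omega> B * \<beta> D - \<omega> D * \<beta> B" "q dvd \<omega> B * \<gamma> D - \<omega> D * \<gamma> B"
    using wb(5) wc(5) b1 c1 w1 by (simp_all add: red)
  have sym: "q dvd x * y - z * u \<Longrightarrow> q dvd z * u - x * y" for x y z u
    by (simp add: dvd_diff_commute)
  have anti: "q dvd \<omega> i * v j - \<omega> j * v i"
    if "q dvd v A" "q dvd \<omega> B * v C - \<omega> C * v B" "q dvd \<omega> B * v D - \<omega> D * v B" "q dvd \<omega> C * v D - \<omega> D * v C" for v i j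
    using that that(2-4)[THEN sym] w1 by (cases i; cases j; simp)
  have w: "q dvd \<omega> i" for i
    by (rule dependent) (rule anti[OF b1 wb(4) wb5(1) wb(6)] anti[OF c1 wc(4) wb5(2) wc(6)])+
  have m: "\<not> q dvd m"
    using independent[of 0 0 0 0 1] w not1 by auto
  \<comment> \<open>Now \<open>m = \<alpha> A * \<beta> B\<close> modulo \<open>q\<close>, and
    \<open>m\<close> is nonzero because the row of \<open>w\<close> is. So \<open>\<alpha> A\<close>
    and \<open>\<beta> B\<close> are invertible, and cancelling them removes the off-diagonal
    entries one by one.\<close>
  have ab1: "q dvd \<alpha> A * \<beta> B - m"
    using dvd_add[OF ab(1) dvd_mult[OF b1, of "\<alpha> B"]] by simp
  have a1: "\<not> q dvd \<alpha> A" and b2: "\<not> q dvd \<beta> B"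
    using ab1 m by (auto simp: red)
  have b3: "q dvd \<beta> C"  using ab(2) b1 a1 mult by (auto simp: red)
  have b4: "q dvd \<beta> D"  using ab(3) b1 a1 mult by (auto simp: red)
  have a3: "q dvd \<alpha> C" using ab(4) b2 b3 mult by (auto simp: red)
  have a4: "q dvd \<alpha> D" using ab(5) b1 b2 b4 n mult by (auto simp: red)
  have d3: "q dvd \<delta> C" using bd(1) w b2 b3 mult by (auto simp: red)
  have bd2: "q dvd \<beta> B * \<delta> D - m * \<alpha> A" 
  proof -
    have "q dvd - (\<beta> D * \<delta> B) + n2 * \<delta> A - n4 * \<beta> A - (\<omega> B * \<alpha> D - \<omega> D * \<alpha> B - n1 * \<omega> A)"
      by (intro dvd_add dvd_diff) (simp_all add: w n b4)
    then have "q dvd (\<beta> B * \<delta> D - \<beta> D * \<delta> B + n2 * \<delta> A - n4 * \<beta> A - (\<omega> B * \<alpha> D - \<omega> D * \<alpha> B + m * \<alpha> A - n1 * \<omega> A))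
       - (- (\<beta> D * \<delta> B) + n2 * \<delta> A - n4 * \<beta> A - (\<omega> B * \<alpha> D - \<omega> D * \<alpha> B - n1 * \<omega> A))"
      using bd(2) by (rule dvd_diff[rotated])
    then show ?thesis by (simp add: algebra_simps)
  qed
  have d4: "\<not> q dvd \<delta> D"
  proof
    assume "q dvd \<delta> D"
    then have "q dvd m * \<alpha> A" using bd2 by (simp add: red)
    then show False using mult m a1 by blast
  qed
  have d2: "q dvd \<delta> B" using pd(1) b1 d1 by (simp add: red)
  \<comment> \<open>The \<open>[b,d]\<close>-coordinate of \<open>d^p = [b,d]\<close>. It is the
    first equation that pins a diagonal entry to \<open>1\<close>; until now such entries were only
    known to be invertible.\<close>
  have "q dvd \<beta> B * \<delta> D - \<delta> D"
  proof -
    have "q dvd (\<beta> B * \<delta> D - \<beta> D * \<delta> B + n2 * \<delta> A - n4 * \<beta> A - (\<delta> C + \<delta> D)) - (- (\<beta> D * \<delta> B) + n2 * \<delta> A - n4 * \<beta> A - \<delta> C)"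
      by (intro dvd_diff[OF pd(2)] dvd_diff dvd_add) (simp_all add: n b4 d3)
    then show ?thesis by (simp add: algebra_simps)
  qed
  also have "\<beta> B * \<delta> D - \<delta> D = (\<beta> B - 1) * \<delta> D" by (simp add: algebra_simps)
  finally have b2': "q dvd \<beta> B - 1" using mult d4 by blast
  have a1c4: "q dvd \<alpha> A * \<gamma> D - \<alpha> B"
  proof -
    have "q dvd (\<alpha> A * \<gamma> D - \<alpha> D * \<gamma> A - \<alpha> B) - (- (\<alpha> D * \<gamma> A))"
      by (intro dvd_diff[OF pa(2)]) (simp add: c1)
    then show ?thesis by (simp add: algebra_simps)
  qed
  have a2c4: "q dvd \<alpha> B * \<gamma> D"
    using pa(3) a3 a4 c1 n by (simp add: red)
  have a2: "q dvd \<alpha> B"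
  proof (rule disjE[OF mult[OF a2c4]])
    assume "q dvd \<gamma> D"
    then show ?thesis using dvd_diff[OF dvd_mult[of q "\<gamma> D" "\<alpha> A"] a1c4] by simp
  qed
  have c4: "q dvd \<gamma> D"
    using dvd_add[OF a1c4 a2] a1 mult by auto
  have c3: "q dvd \<gamma> C - 1"
  proof -
    have "q dvd (\<alpha> A * \<gamma> C - \<alpha> C * \<gamma> A - (\<alpha> A + \<alpha> B)) - (- (\<alpha> C * \<gamma> A) - \<alpha> B)"
      by (intro dvd_diff[OF pa(1)] dvd_diff) (simp_all add: c1 a2)
    then have "q dvd \<alpha> A * (\<gamma> C - 1)" by (simp add: algebra_simps)
    then show ?thesis using mult a1 by blast
  qed
  \<comment> \<open>The \<open>[a,c]\<close>-coordinate of \<open>b^p = [a,bcd]\<close> has shrunk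
    to \<open>\<alpha> A * \<gamma> C = \<beta> B\<close>, with \<open>\<gamma> C\<close> and
    \<open>\<beta> B\<close> already equal to \<open>1\<close> modulo \<open>q\<close>.\<close>
  have a1': "q dvd \<alpha> A - 1"
  proof -
    have "q dvd (\<alpha> A * (\<beta> C + \<gamma> C + \<delta> C) - \<alpha> C * (\<beta> A + \<gamma> A + \<delta> A) - (\<beta> A + \<beta> B))
      - (\<alpha> A * (\<beta> C + (\<gamma> C - 1) + \<delta> C) - \<alpha> C * (\<beta> A + \<gamma> A + \<delta> A) - (\<beta> A + (\<beta> B - 1)))"
      by (intro dvd_diff[OF pb] dvd_diff dvd_mult dvd_add a3 b1 b2' b3 c1 c3 d1 d3)
    then show ?thesis by (simp add: algebra_simps)
  qed
  have c2: "q dvd \<gamma> B"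
    using pc b1 b3 c1 by (simp add: red)
  have m1: "q dvd m - 1"
  proof -
    have "q dvd \<alpha> A * (\<beta> B - 1) + (\<alpha> A - 1) - (\<alpha> A * \<beta> B - m)"
      by (intro dvd_add dvd_diff dvd_mult a1' b2' ab1)
    then show ?thesis by (simp add: algebra_simps)
  qed
  have d4': "q dvd \<delta> D - 1"
  proof -
    have "q dvd (\<beta> B * \<delta> D - m * \<alpha> A) - (\<beta> B - 1) * \<delta> D + (m - 1) * \<alpha> A + (\<alpha> A - 1)"
      by (intro dvd_add dvd_diff bd2 dvd_mult2 a1' b2' m1)
    then show ?thesis by (simp add: algebra_simps)
  qed
  have all: "\<forall>i. P i" if "P A" "P B" "P C" "P D" for P
    using that by (metis H_gen.exhaust)
  show ?thesis
    by (intro conjI all) (use a1' a2 a3 a4 b1 b2' b3 b4 c1 c2 c3 c4 d1 d2 d3 d4' w m1 in simp_all)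
qed

section \<open>The group \<open>G\<close> in coordinates\<close>

locale amalgam = group G for G (structure) +
  fixes p :: nat and H :: "'a set" and a b c d w :: 'a
  assumes prime: "Factorial_Ring.prime p" and odd: "odd p"
    and pres: "presented_by (G\<lparr>carrier := H\<rparr>) (H_relations p) (case_H_gen a b c d)"
    and w_closed [simp]: "w \<in> carrier G" and ord_w: "ord w = p ^ 3"
    and amalg: "amalgamated_semidirect_product G H (generate G {w}) (generate G {w [^] (p ^ 2)})"
    and wa: "w \<otimes> a \<otimes> inv w = a \<otimes> d [^] p"
    and wb: "w \<otimes> b \<otimes> inv w = b"
    and wc: "w \<otimes> c \<otimes> inv w = c"
    and wd: "w \<otimes> d \<otimes> inv w = d"
begin

section \<open>Relations of \<open>H\<close> inside \<open>G\<close> and the action of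
  \<open>w\<close>\<close>

lemma p_pos: "p > 0"
  using prime prime_gt_0_nat by blast

lemma prime_int: "Factorial_Ring.prime (int p)"
  using prime by simp

lemma normal_H: "H \<lhd> G"
  using amalg by (simp add: amalgamated_semidirect_product_def)

lemma subgroup_H: "subgroup H G"
  using normal_H by (rule normal_imp_subgroup)

lemma H_closed: "h \<in> H \<Longrightarrow> h \<in> carrier G"
  using subgroup_H by (rule subgroup.mem_carrier)

abbreviation "gens \<equiv> case_H_gen a b c d"

abbreviation "ev \<equiv> term_eval G gens"

lemmas ev_facts = presented_by_term_eval[OF subgroup_H pres]

lemma gens_H: "a \<in> H" "b \<in> H" "c \<in> H" "d \<in> H"
  using ev_facts(1)[of A] ev_facts(1)[of B] ev_facts(1)[of C] ev_facts(1)[of D] by simp_all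

lemma gens_closed [simp]: "a \<in> carrier G" "b \<in> carrier G" "c \<in> carrier G" "d \<in> carrier G"
  using gens_H H_closed by blast+

lemma ev_H: "ev s \<in> H"
  using ev_facts(2) by blast

lemma ev_rel: "(s, t) \<in> H_relations p \<Longrightarrow> ev s = ev t"
  using ev_facts(3) by (blast intro: pres_eq.rel)

lemma power_relations:
  "a [^] p = commutator G a c" "b [^] p = commutator G a (b \<otimes> c \<otimes> d)"
  "c [^] p = commutator G b (c \<otimes> d)" "d [^] p = commutator G b d"
  using ev_rel[of "Pow (Gen A) p" "Comm (Gen A) (Gen C)"]
    ev_rel[of "Pow (Gen B) p" "Comm (Gen A) (Mult (Mult (Gen B) (Gen C)) (Gen D))"]
    ev_rel[of "Pow (Gen C) p" "Comm (Gen B) (Mult (Gen C) (Gen D))"]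
    ev_rel[of "Pow (Gen D) p" "Comm (Gen B) (Gen D)"]
  by (simp_all add: H_relations_def term_eval_Pow term_eval_Comm)

lemma commutator_H:
  assumes "x \<in> H" "y \<in> H"
  shows "commutator G x y \<in> H"
  using assms subgroup_H unfolding commutator_def
  by (simp add: subgroup.m_closed subgroup.m_inv_closed)

lemma class2_H:
  assumes "x \<in> H" "y \<in> H" "z \<in> H"
  shows "commutator G x y \<otimes> z = z \<otimes> commutator G x y"
proof -
  obtain s t u where st: "x = ev s" "y = ev t" "z = ev u"
    using assms ev_facts(2) by (metis imageE)
  have "commutator G (commutator G x y) z = \<one>"
    using ev_rel[of "Comm (Comm s t) u" Unit] by (auto simp: st H_relations_def term_eval_Comm)
  then show ?thesis
    using assms by (simp add: commutator_eq_one_iff H_closed)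
qed

lemma carrier_form: "x \<in> carrier G \<longleftrightarrow> (\<exists>h \<in> H. \<exists>n::int. x = h \<otimes> w [^] n)"
proof -
  have "carrier G = H <#> generate G {w}"
    using amalg by (simp add: amalgamated_semidirect_product_def)
  then show ?thesis
    unfolding generate_pow[OF w_closed] set_mult_def by auto
qed

lemma center_if_commutes:
  assumes z: "z \<in> carrier G" and "\<And>h. h \<in> H \<Longrightarrow> z \<otimes> h = h \<otimes> z" and zw: "z \<otimes> w = w \<otimes> z"
  shows "z \<in> center G"
proof (rule centerI[OF z])
  fix x assume "x \<in> carrier G"
  then obtain h n where h: "h \<in> H" and x: "x = h \<otimes> w [^] (n::int)"
    using carrier_form by blast
  show "z \<otimes> x = x \<otimes> z"
    using assms(2)[OF h] int_pow_commute[OF zw z w_closed, of 1 n] z H_closed[OF h] unfolding x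
    by (metis int_pow_1 int_pow_closed m_assoc w_closed)
qed

lemma w_commute: "w \<otimes> b = b \<otimes> w" "w \<otimes> c = c \<otimes> w" "w \<otimes> d = d \<otimes> w"
  using wb wc wd by (simp_all add: inv_solve_right')

lemma w_a: "w \<otimes> a = a \<otimes> commutator G b d \<otimes> w"
  using wa by (simp add: inv_solve_right' power_relations)

lemma commutator_center_if_fixed:
  assumes "x \<in> H" "y \<in> H" "commutator G (w \<otimes> x \<otimes> inv w) (w \<otimes> y \<otimes> inv w) = commutator G x y"
  shows "commutator G x y \<in> center G"
proof (rule center_if_commutes)
  have "w \<otimes> commutator G x y \<otimes> inv w = commutator G x y"
    using assms by (simp add: conj_commutator H_closed)
  then show "commutator G x y \<otimes> w = w \<otimes> commutator G x y"
    using assms by (simp add: inv_solve_right' H_closed)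
qed (use assms class2_H H_closed in auto)

text \<open>The commutator \<open>[b,d]\<close> has to come before those involving \<open>a\<close>:
  conjugation by \<open>w\<close> multiplies \<open>a\<close> by \<open>d^p = [b,d]\<close>, a
  factor that disappears from a commutator only once it is known to be central in
  \<open>G\<close>.\<close>

lemma t_center:
  "commutator G a b \<in> center G" "commutator G a c \<in> center G" "commutator G a d \<in> center G"
  "commutator G b c \<in> center G" "commutator G b d \<in> center G" "commutator G c d \<in> center G"
proof -
  show bd: "commutator G b d \<in> center G" and "commutator G b c \<in> center G" "commutator G c d \<in> center G"
    by (rule commutator_center_if_fixed; simp add: gens_H wb wc wd)+
  have wa': "w \<otimes> a \<otimes> inv w = a \<otimes> commutator G b d"
    by (simp add: wa power_relations)
  show "commutator G a b \<in> center G" "commutator G a c \<in> center G" "commutator G a d \<in> center G"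
    by (rule commutator_center_if_fixed; simp add: gens_H wa' wb wc wd commutator_center_mult_left[OF bd])+
qed

section \<open>Additive coordinates for commutators and collection of words\<close>

definition T :: "int \<Rightarrow> int \<Rightarrow> int \<Rightarrow> int \<Rightarrow> int \<Rightarrow> int \<Rightarrow> 'a" where
  "T z1 z2 z3 z4 z5 z6 = commutator G a b [^] z1 \<otimes> (commutator G a c [^] z2 \<otimes> (commutator G a d [^] z3 \<otimes>
     (commutator G b c [^] z4 \<otimes> (commutator G b d [^] z5 \<otimes> commutator G c d [^] z6))))"

lemma T_center: "T z1 z2 z3 z4 z5 z6 \<in> center G"
  unfolding T_def
  by (intro subgroup.m_closed[OF center_subgroup] subgroup_int_pow_closed[OF center_subgroup] t_center)

lemma T_closed [simp]: "T z1 z2 z3 z4 z5 z6 \<in> carrier G"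
  using T_center by (rule center_carrier)

lemma ev_comm_word: "ev (comm_word z1 z2 z3 z4 z5 z6) = T z1 z2 z3 z4 z5 z6"
  by (simp add: comm_word_def T_def term_eval_IPow term_eval_Comm)

lemma T_H: "T z1 z2 z3 z4 z5 z6 \<in> H"
  using ev_H ev_comm_word by metis

lemma T_add:
  "T z1 z2 z3 z4 z5 z6 \<otimes> T y1 y2 y3 y4 y5 y6 = T (z1 + y1) (z2 + y2) (z3 + y3) (z4 + y4) (z5 + y5) (z6 + y6)"
proof -
  have AC: "x \<otimes> y = y \<otimes> x" "x \<otimes> (y \<otimes> z) = y \<otimes> (x \<otimes> z)"
    if "x \<in> center G" "y \<in> center G" "z \<in> center G" for x y z
    using that by (metis centerD center_carrier m_assoc)+
  have m: "x \<otimes> y \<otimes> z = x \<otimes> (y \<otimes> z)"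
    if "x \<in> center G" "y \<in> center G" "z \<in> center G" for x y z
    using that by (metis center_carrier m_assoc)
  note cl = t_center subgroup.m_closed[OF center_subgroup] subgroup_int_pow_closed[OF center_subgroup]
  show ?thesis
    unfolding T_def by (simp add: int_pow_mult cl m AC)
qed

lemma T_0 [simp]: "T 0 0 0 0 0 0 = \<one>"
  by (simp add: T_def)

lemma T_inv: "inv (T z1 z2 z3 z4 z5 z6) = T (- z1) (- z2) (- z3) (- z4) (- z5) (- z6)"
  by (rule inv_equality) (simp_all add: T_add)

lemma T_pow: "T z1 z2 z3 z4 z5 z6 [^] (n::int) = T (n * z1) (n * z2) (n * z3) (n * z4) (n * z5) (n * z6)"
proof -
  have nat: "T z1 z2 z3 z4 z5 z6 [^] k = T (k * z1) (k * z2) (k * z3) (k * z4) (k * z5) (k * z6)" for k :: nat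
    by (induction k) (simp_all add: T_add algebra_simps)
  show ?thesis
    by (cases n rule: int_cases2) (simp_all add: nat int_pow_int int_pow_neg_int T_inv)
qed

lemma T_commute: "x \<in> carrier G \<Longrightarrow> T z1 z2 z3 z4 z5 z6 \<otimes> x = x \<otimes> T z1 z2 z3 z4 z5 z6"
  using T_center by (rule centerD)

lemma T_units:
  "commutator G a b [^] n = T n 0 0 0 0 0" "commutator G a c [^] n = T 0 n 0 0 0 0"
  "commutator G a d [^] n = T 0 0 n 0 0 0" "commutator G b c [^] n = T 0 0 0 n 0 0"
  "commutator G b d [^] n = T 0 0 0 0 n 0" "commutator G c d [^] n = T 0 0 0 0 0 n"
  by (simp_all add: T_def)

lemma swap_gens:
  "b [^] n \<otimes> a [^] m = a [^] m \<otimes> (b [^] n \<otimes> T (- (n * m)) 0 0 0 0 0)"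
  "c [^] n \<otimes> a [^] m = a [^] m \<otimes> (c [^] n \<otimes> T 0 (- (n * m)) 0 0 0 0)"
  "d [^] n \<otimes> a [^] m = a [^] m \<otimes> (d [^] n \<otimes> T 0 0 (- (n * m)) 0 0 0)"
  "c [^] n \<otimes> b [^] m = b [^] m \<otimes> (c [^] n \<otimes> T 0 0 0 (- (n * m)) 0 0)"
  "d [^] n \<otimes> b [^] m = b [^] m \<otimes> (d [^] n \<otimes> T 0 0 0 0 (- (n * m)) 0)"
  "d [^] n \<otimes> c [^] m = c [^] m \<otimes> (d [^] n \<otimes> T 0 0 0 0 0 (- (n * m)))"
  "w [^] n \<otimes> a [^] m = a [^] m \<otimes> (w [^] n \<otimes> T 0 0 0 0 (n * m) 0)"
  "w [^] n \<otimes> b [^] m = b [^] m \<otimes> w [^] n"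
  "w [^] n \<otimes> c [^] m = c [^] m \<otimes> w [^] n"
  "w [^] n \<otimes> d [^] m = d [^] m \<otimes> w [^] n"
  for n m :: int
proof -
  have *: "y [^] n \<otimes> x [^] m = x [^] m \<otimes> (y [^] n \<otimes> commutator G x y [^] (- (n * m)))"
    if x: "x \<in> carrier G" and y: "y \<in> carrier G" and t: "commutator G x y \<in> center G" for x y and n m :: int
  proof -
    let ?t = "commutator G x y"
    have it: "inv ?t \<in> center G" using t by (rule subgroup.m_inv_closed[OF center_subgroup])
    have "y \<otimes> x = inv ?t \<otimes> (x \<otimes> y)"
      using commutator_swap[OF x y] x y by (simp add: inv_solve_left)
    then have "y \<otimes> x = x \<otimes> y \<otimes> inv ?t"
      using centerD[OF it, of "x \<otimes> y"] x y by simp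
    then have "y [^] n \<otimes> x [^] m = x [^] m \<otimes> (y [^] n \<otimes> inv ?t [^] (n * m))"
      using x y centerD[OF it] by (intro int_pow_mult_swap) auto
    then show ?thesis using x y by (simp add: int_pow_inv int_pow_neg)
  qed
  show "b [^] n \<otimes> a [^] m = a [^] m \<otimes> (b [^] n \<otimes> T (- (n * m)) 0 0 0 0 0)"
  "c [^] n \<otimes> a [^] m = a [^] m \<otimes> (c [^] n \<otimes> T 0 (- (n * m)) 0 0 0 0)"
  "d [^] n \<otimes> a [^] m = a [^] m \<otimes> (d [^] n \<otimes> T 0 0 (- (n * m)) 0 0 0)"
  "c [^] n \<otimes> b [^] m = b [^] m \<otimes> (c [^] n \<otimes> T 0 0 0 (- (n * m)) 0 0)"
  "d [^] n \<otimes> b [^] m = b [^] m \<otimes> (d [^] n \<otimes> T 0 0 0 0 (- (n * m)) 0)"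
  "d [^] n \<otimes> c [^] m = c [^] m \<otimes> (d [^] n \<otimes> T 0 0 0 0 0 (- (n * m)))"
    unfolding T_units[symmetric] by (rule *; simp add: t_center)+
  \<comment> \<open>Here \<open>[w,a] = [b,d]\<close> has \<open>w\<close> on the left, which
    explains why the exponent \<open>n * m\<close> is positive, unlike in the rules for two
    generators of \<open>H\<close>.\<close>
  have "w \<otimes> a = a \<otimes> w \<otimes> commutator G b d"
    using w_a centerD[OF t_center(5) w_closed] by (simp add: m_assoc)
  then show "w [^] n \<otimes> a [^] m = a [^] m \<otimes> (w [^] n \<otimes> T 0 0 0 0 (n * m) 0)"
    unfolding T_units[symmetric] using centerD[OF t_center(5)] by (intro int_pow_mult_swap) auto
  show  "w [^] n \<otimes> b [^] m = b [^] m \<otimes> w [^] n"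
  "w [^] n \<otimes> c [^] m = c [^] m \<otimes> w [^] n"
  "w [^] n \<otimes> d [^] m = d [^] m \<otimes> w [^] n"
    by (rule int_pow_commute; simp add: w_commute)+
qed

lemma T_add_assoc:
  "x \<in> carrier G \<Longrightarrow> T z1 z2 z3 z4 z5 z6 \<otimes> (T y1 y2 y3 y4 y5 y6 \<otimes> x) = T (z1 + y1) (z2 + y2) (z3 + y3) (z4 + y4) (z5 + y5) (z6 + y6) \<otimes> x"
  by (simp add: T_add flip: m_assoc)

lemma T_left_commute: 
  "x \<in> carrier G \<Longrightarrow> y \<in> carrier G \<Longrightarrow> T z1 z2 z3 z4 z5 z6 \<otimes> (x \<otimes> y) = x \<otimes> (T z1 z2 z3 z4 z5 z6 \<otimes> y)"
  by (rule left_swap) (simp_all add: T_commute)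

lemmas collect_T =
  T_commute[of "a [^] n"] T_left_commute[of "a [^] n"] 
  T_commute[of "b [^] n"] T_left_commute[of "b [^] n"] 
  T_commute[of "c [^] n"] T_left_commute[of "c [^] n"] 
  T_commute[of "d [^] n"] T_left_commute[of "d [^] n"] 
  T_commute[of "w [^] n"] T_left_commute[of "w [^] n"] for n :: int

text \<open>As rewrite rules these move powers into the order \<open>a\<close>, \<open>b\<close>,
  \<open>c\<close>, \<open>d\<close>, \<open>w\<close> and gather all commutators in a single
  \<open>T\<close> at the right end.\<close>

lemmas collect = m_assoc swap_gens swap_gens[THEN left_swap] int_pow_mult[symmetric] int_pow_mult_assoc
  T_add T_add_assoc collect_T

definition E :: "(H_gen \<Rightarrow> int) \<Rightarrow> int \<Rightarrow> 'a" where
  "E u n = a [^] u A \<otimes> (b [^] u B \<otimes> (c [^] u C \<otimes> (d [^] u D \<otimes> w [^] n)))"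

lemma E_closed [simp]: "E u n \<in> carrier G"
  by (simp add: E_def)

lemma E_mult:
  "E u n \<otimes> E v m = E (\<lambda>i. u i + v i) (n + m) \<otimes>
    T (- (u B * v A)) (- (u C * v A)) (- (u D * v A)) (- (u C * v B)) (n * v A - u D * v B) (- (u D * v C))"
  unfolding E_def by (simp add: collect)

text \<open>The difference of the \<open>T\<close>-terms of the two products in
  \<open>E_mult\<close>. The fifth entry also receives \<open>[w,a] = [b,d]\<close>, hence the
  summands with \<open>n\<close> and \<open>m\<close>.\<close>

lemma commutator_E:
  "commutator G (E u n) (E v m) = T (u A * v B - u B * v A) (u A * v C - u C * v A) (u A * v D - u D * v A)
    (u B * v C - u C * v B) (u B * v D - u D * v B + n * v A - m * u A) (u C * v D - u D * v C)"
  by (rule commutator_eqI)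
    (simp_all add: E_mult T_left_commute[of "E u n"] T_left_commute[of "E _ _"] T_add add.commute algebra_simps)

lemma gens_E:
  "a = E (case_H_gen 1 0 0 0) 0" "b = E (case_H_gen 0 1 0 0) 0" "c = E (case_H_gen 0 0 1 0) 0"
  "d = E (case_H_gen 0 0 0 1) 0" "w = E (\<lambda>_. 0) 1" "c \<otimes> d = E (case_H_gen 0 0 1 1) 0"
  "b \<otimes> c \<otimes> d = E (case_H_gen 0 1 1 1) 0"
  by (simp_all add: E_def m_assoc)

lemma powers_T:
  "a [^] p = T 0 1 0 0 0 0" "b [^] p = T 1 1 1 0 0 0" "c [^] p = T 0 0 0 1 1 0" "d [^] p = T 0 0 0 0 1 0"
  using commutator_E[of "case_H_gen 1 0 0 0" 0 "case_H_gen 0 0 1 0" 0]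
    commutator_E[of "case_H_gen 1 0 0 0" 0 "case_H_gen 0 1 1 1" 0]
    commutator_E[of "case_H_gen 0 1 0 0" 0 "case_H_gen 0 0 1 1" 0]
    commutator_E[of "case_H_gen 0 1 0 0" 0 "case_H_gen 0 0 0 1" 0]
  unfolding power_relations gens_E[symmetric] by simp_all

lemma gens_pow_p:
  "a [^] (int p * k) = T 0 k 0 0 0 0" "b [^] (int p * k) = T k k k 0 0 0"
  "c [^] (int p * k) = T 0 0 0 k k 0" "d [^] (int p * k) = T 0 0 0 0 k 0"
proof -
  have *: "x [^] (int p * k) = (x [^] p) [^] k" if "x \<in> carrier G" for x
    using int_pow_pow[OF that, of "int p" k] by (simp add: int_pow_int)
  show "a [^] (int p * k) = T 0 k 0 0 0 0" "b [^] (int p * k) = T k k k 0 0 0"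
    "c [^] (int p * k) = T 0 0 0 k k 0" "d [^] (int p * k) = T 0 0 0 0 k 0"
    by (simp_all add: * powers_T T_pow)
qed

text \<open>The \<open>p\<close>-th powers of \<open>a\<close>, \<open>b\<close>, \<open>c\<close>
  are products of commutators and hence central. Swapping such a power with another generator costs
  nothing, but by the swap rules it costs the \<open>p\<close>-th power of their commutator.\<close>

lemma T_trivial_if_dvd:
  assumes "int p dvd z1" "int p dvd z2" "int p dvd z3" "int p dvd z4" "int p dvd z5" "int p dvd z6"
  shows "T z1 z2 z3 z4 z5 z6 = \<one>"
proof -
  have *: "t = \<one>" if "y \<otimes> x = x \<otimes> (y \<otimes> t)" "x \<in> center G" "y \<in> carrier G" "t \<in> carrier G" for x y t
    using that centerD[of x G y] center_carrier[of x G] by (metis l_cancel_one' m_assoc m_closed)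
  have pc: "a [^] int p \<in> center G" "b [^] int p \<in> center G" "c [^] int p \<in> center G"
    by (simp_all add: int_pow_int powers_T T_center)
  have t: "T (- int p) 0 0 0 0 0 = \<one>" "T 0 (- int p) 0 0 0 0 = \<one>" "T 0 0 (- int p) 0 0 0 = \<one>"
    "T 0 0 0 (- int p) 0 0 = \<one>" "T 0 0 0 0 (- int p) 0 = \<one>" "T 0 0 0 0 0 (- int p) = \<one>"
    using *[OF _ pc(1), of b] swap_gens(1)[of 1 "int p"] *[OF _ pc(1), of c] swap_gens(2)[of 1 "int p"]
      *[OF _ pc(1), of d] swap_gens(3)[of 1 "int p"] *[OF _ pc(2), of c] swap_gens(4)[of 1 "int p"]
      *[OF _ pc(2), of d] swap_gens(5)[of 1 "int p"] *[OF _ pc(3), of d] swap_gens(6)[of 1 "int p"]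
    by simp_all
  obtain k1 k2 k3 k4 k5 k6 where "z1 = int p * k1" "z2 = int p * k2" "z3 = int p * k3" "z4 = int p * k4"
    "z5 = int p * k5" "z6 = int p * k6"
    using assms unfolding dvd_def by blast
  moreover have "T (int p * k1) (int p * k2) (int p * k3) (int p * k4) (int p * k5) (int p * k6) =
    T (- int p) 0 0 0 0 0 [^] (- k1) \<otimes> T 0 (- int p) 0 0 0 0 [^] (- k2) \<otimes> T 0 0 (- int p) 0 0 0 [^] (- k3) \<otimes>
    T 0 0 0 (- int p) 0 0 [^] (- k4) \<otimes> T 0 0 0 0 (- int p) 0 [^] (- k5) \<otimes> T 0 0 0 0 0 (- int p) [^] (- k6)"
    by (simp add: T_pow T_add mult.commute)
  ultimately show ?thesis by (simp add: t)
qed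

lemma T_eq_one_iff:
  "T z1 z2 z3 z4 z5 z6 = \<one> \<longleftrightarrow>
    int p dvd z1 \<and> int p dvd z2 \<and> int p dvd z3 \<and> int p dvd z4 \<and> int p dvd z5 \<and> int p dvd z6"
proof
  assume "T z1 z2 z3 z4 z5 z6 = \<one>"
  then have "ev (comm_word z1 z2 z3 z4 z5 z6) = ev Unit"
    by (simp add: ev_comm_word)
  then have "pres_eq (H_relations p) (comm_word z1 z2 z3 z4 z5 z6) Unit"
    using ev_facts(3) by blast
  from comm_word_trivial[OF p_pos this]
  show "int p dvd z1 \<and> int p dvd z2 \<and> int p dvd z3 \<and> int p dvd z4 \<and> int p dvd z5 \<and> int p dvd z6"
    by blast
qed (blast intro: T_trivial_if_dvd)

lemma T_eq_iff:
  "T z1 z2 z3 z4 z5 z6 = T y1 y2 y3 y4 y5 y6 \<longleftrightarrow>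
    int p dvd z1 - y1 \<and> int p dvd z2 - y2 \<and> int p dvd z3 - y3 \<and>
    int p dvd z4 - y4 \<and> int p dvd z5 - y5 \<and> int p dvd z6 - y6"
proof -
  have "T z1 z2 z3 z4 z5 z6 = T y1 y2 y3 y4 y5 y6 \<longleftrightarrow>
      T z1 z2 z3 z4 z5 z6 \<otimes> inv (T y1 y2 y3 y4 y5 y6) = \<one>"
    by (metis T_closed inv_closed inv_equality inv_inv r_inv)
  also have "T z1 z2 z3 z4 z5 z6 \<otimes> inv (T y1 y2 y3 y4 y5 y6)
      = T (z1 - y1) (z2 - y2) (z3 - y3) (z4 - y4) (z5 - y5) (z6 - y6)"
    by (simp add: T_inv T_add)
  finally show ?thesis by (simp add: T_eq_one_iff)
qed

lemma w_pow_eq_one_iff: "w [^] (n::int) = \<one> \<longleftrightarrow> int p ^ 3 dvd n"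
  using int_pow_eq_id[OF w_closed, of n] by (simp add: ord_w)

lemma w_pow_H_iff: "w [^] (n::int) \<in> H \<longleftrightarrow> int p ^ 2 dvd n"
proof -
  have HM: "H \<inter> generate G {w} = generate G {w [^] (p ^ 2)}"
    using amalg by (simp add: amalgamated_semidirect_product_def)
  have gen: "generate G {w [^] (p ^ 2)} = {w [^] (int p ^ 2 * k) | k. k \<in> UNIV}"
    using int_pow_pow[OF w_closed, of "int (p ^ 2)"]
    by (simp add: generate_pow int_pow_int[symmetric])
  have "w [^] n \<in> generate G {w}"
    using generate_pow[OF w_closed] by blast
  then have "w [^] n \<in> H \<longleftrightarrow> (\<exists>k. w [^] n = w [^] (int p ^ 2 * k))"
    using HM gen by blast
  also have "\<dots> \<longleftrightarrow> int p ^ 2 dvd n"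
  proof
    assume "\<exists>k. w [^] n = w [^] (int p ^ 2 * k)"
    then obtain k where "w [^] n = w [^] (int p ^ 2 * k)" by blast
    then have "w [^] (n - int p ^ 2 * k) = \<one>"
      by (simp add: int_pow_diff)
    \<comment> \<open>Exponents of \<open>w\<close> matter modulo \<open>p^3\<close>, a multiple of
      \<open>p^2\<close>, so divisibility by \<open>p^2\<close> is not affected.\<close>
    then have "int p ^ 3 dvd n - int p ^ 2 * k" by (simp add: w_pow_eq_one_iff)
    then have "int p ^ 2 dvd n - int p ^ 2 * k"
      by (rule dvd_trans[rotated]) (simp add: le_imp_power_dvd)
    then show "int p ^ 2 dvd n" by (simp add: dvd_diff_left_iff)
  qed (auto elim!: dvdE)
  finally show ?thesis .
qed

lemma E_mult_assoc:
  "t \<in> carrier G \<Longrightarrow> E u n \<otimes> (E v m \<otimes> t) = E (\<lambda>i. u i + v i) (n + m) \<otimes>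
    (T (- (u B * v A)) (- (u C * v A)) (- (u D * v A)) (- (u C * v B)) (n * v A - u D * v B) (- (u D * v C)) \<otimes> t)"
  by (subst m_assoc[symmetric]) (simp_all add: E_mult m_assoc)

lemma E_nat_pow:
  "E u n [^] k = E (\<lambda>i. int k * u i) (int k * n) \<otimes>
    T (- (int (k choose 2) * (u B * u A))) (- (int (k choose 2) * (u C * u A))) (- (int (k choose 2) * (u D * u A)))
      (- (int (k choose 2) * (u C * u B))) (int (k choose 2) * (n * u A - u D * u B)) (- (int (k choose 2) * (u D * u C)))"
proof (induction k)
  case 0
  then show ?case by (simp add: E_def numeral_2_eq_2)
next
  case (Suc k)
  have "Suc k choose 2 = k + (k choose 2)"
    by (simp add: numeral_2_eq_2)
  then show ?case
    by (simp add: Suc m_assoc T_commute[of "E _ _"] E_mult_assoc T_add) (simp add: algebra_simps)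
qed

text \<open>For odd \<open>p\<close> the binomial coefficient of \<open>p\<close> over 2 is
  divisible by \<open>p\<close>, so the correction in \<open>E_nat_pow\<close> disappears and the
  \<open>p\<close>-th power is linear in the exponents.\<close>

lemma E_pow_p:
  "E u n [^] p = T (u B) (u A + u B) (u B) (u C) (u C + u D) 0 \<otimes> w [^] (int p * n)"
proof -
  have "p > 2" using prime odd by (metis even_numeral le_neq_implies_less prime_ge_2_nat)
  then have "p dvd (p choose 2)"
    using prime by (intro dvd_choose_prime) auto
  then have "int p dvd int (p choose 2)" by simp
  then have "E u n [^] p = E (\<lambda>i. int p * u i) (int p * n)"
    by (simp add: E_nat_pow T_trivial_if_dvd)
  also have "\<dots> = T (u B) (u A + u B) (u B) (u C) (u C + u D) 0 \<otimes> w [^] (int p * n)"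
    by (simp add: E_def gens_pow_p T_add T_add_assoc algebra_simps)
  finally show ?thesis .
qed

text \<open>A relation and not a function, because exponents are not unique: \<open>a^p\<close>, for
  instance, is itself a \<open>T\<close>. Admitting arbitrary integers keeps products, inverses and
  powers linear in the coordinates.\<close>

definition coords :: "'a \<Rightarrow> (H_gen \<Rightarrow> int) \<Rightarrow> int \<Rightarrow> bool" where
  "coords x u n \<longleftrightarrow> (\<exists>z1 z2 z3 z4 z5 z6. x = E u n \<otimes> T z1 z2 z3 z4 z5 z6)"

lemma coords_E: "coords (E u n) u n"
  unfolding coords_def by (rule exI[of _ 0])+ simp

lemma coords_T: "coords (T z1 z2 z3 z4 z5 z6) (\<lambda>_. 0) 0"
  unfolding coords_def by (rule exI)+ (simp add: E_def)

lemma coords_closed: "coords x u n \<Longrightarrow> x \<in> carrier G"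
  by (auto simp: coords_def)

lemma coords_mult:
  assumes "coords x u n" "coords y v m"
  shows "coords (x \<otimes> y) (\<lambda>i. u i + v i) (n + m)"
proof -
  obtain z1 z2 z3 z4 z5 z6 y1 y2 y3 y4 y5 y6
    where "x = E u n \<otimes> T z1 z2 z3 z4 z5 z6" "y = E v m \<otimes> T y1 y2 y3 y4 y5 y6"
    using assms unfolding coords_def by blast
  then have "x \<otimes> y = E u n \<otimes> E v m \<otimes> T (z1 + y1) (z2 + y2) (z3 + y3) (z4 + y4) (z5 + y5) (z6 + y6)"
    by (simp add: m_assoc T_left_commute[of "E _ _"] T_add)
  then show ?thesis
    unfolding coords_def by (simp add: E_mult m_assoc T_add) blast
qed

lemma coords_inv:
  assumes "coords x u n"
  shows "coords (inv x) (\<lambda>i. - u i) (- n)"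
proof -
  have "coords (E (\<lambda>i. - u i) (- n) \<otimes> x) (\<lambda>i. 0) 0"
    using coords_mult[OF coords_E assms, of "\<lambda>i. - u i" "- n"] by simp
  then obtain z1 z2 z3 z4 z5 z6 where "E (\<lambda>i. - u i) (- n) \<otimes> x = T z1 z2 z3 z4 z5 z6"
    unfolding coords_def by (auto simp: E_def)
  then have "T (-z1) (-z2) (-z3) (-z4) (-z5) (-z6) \<otimes> (E (\<lambda>i. - u i) (- n) \<otimes> x) = \<one>"
    by (simp add: T_add)
  then have "inv x = T (-z1) (-z2) (-z3) (-z4) (-z5) (-z6) \<otimes> E (\<lambda>i. - u i) (- n)"
    using coords_closed[OF assms] by (intro inv_equality) (simp_all add: m_assoc)
  then show ?thesis unfolding coords_def by (subst (asm) T_commute) (simp, blast)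
qed

lemma coords_int_pow:
  assumes "coords x u n"
  shows "coords (x [^] (k::int)) (\<lambda>i. k * u i) (k * n)"
proof -
  have nat: "coords (x [^] j) (\<lambda>i. int j * u i) (int j * n)" for j :: nat
  proof (induction j)
    case 0 then show ?case using coords_T[of 0 0 0 0 0 0] by simp
  next
    case (Suc j)
    from coords_mult[OF Suc assms] show ?case by (simp add: algebra_simps)
  qed
  show ?thesis
  proof (cases k rule: int_cases2)
    case (nonneg j) then show ?thesis using nat[of j] by (simp add: int_pow_int)
  next
    case (nonpos j) then show ?thesis
      using coords_inv[OF nat[of j]] coords_closed[OF assms] by (simp add: int_pow_neg_int)
  qed
qed

lemma coords_gens:
  "coords a (case_H_gen 1 0 0 0) 0" "coords b (case_H_gen 0 1 0 0) 0" "coords c (case_H_gen 0 0 1 0) 0"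
  "coords d (case_H_gen 0 0 0 1) 0" "coords w (\<lambda>_. 0) 1"
  using coords_E gens_E(1-5) by metis+

lemma coords_H:
  assumes "x \<in> H"
  obtains u where "coords x u 0"
proof -
  have "\<exists>u. coords (ev s) u 0" for s
  proof (induction s)
    case (Gen i) then show ?case using coords_gens by (cases i) auto
  next
    case Unit then show ?case using coords_T[of 0 0 0 0 0 0] by auto
  next
    case (Mult s t)
    then obtain u v where "coords (ev s) u 0" "coords (ev t) v 0" by blast
    from coords_mult[OF this] show ?case by auto
  next
    case (Inv s)
    then obtain u where "coords (ev s) u 0" by blast
    from coords_inv[OF this] show ?case by auto
  qed
  then show ?thesis using assms ev_facts(2) that by (metis imageE)
qed

lemma coords_exist:
  assumes "x \<in> carrier G"
  obtains u n where "coords x u n"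
proof -
  obtain h n where h: "h \<in> H" and x: "x = h \<otimes> w [^] (n::int)"
    using assms carrier_form by blast
  obtain u where "coords h u 0" using coords_H[OF h] by blast
  from coords_mult[OF this coords_int_pow[OF coords_gens(5), of n]] show ?thesis
    using that x by simp
qed

lemma coords_commutator:
  assumes "coords x u n" "coords y v m"
  shows "commutator G x y = T (u A * v B - u B * v A) (u A * v C - u C * v A) (u A * v D - u D * v A)
    (u B * v C - u C * v B) (u B * v D - u D * v B + n * v A - m * u A) (u C * v D - u D * v C)"
  using assms unfolding coords_def
  by (auto simp: commutator_center_mult_left[OF T_center] commutator_center_mult_right[OF T_center] commutator_E)

lemma coords_pow_p:
  assumes "coords x u n"
  shows "x [^] p = T (u B) (u A + u B) (u B) (u C) (u C + u D) 0 \<otimes> w [^] (int p * n)"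
proof -
  obtain z1 z2 z3 z4 z5 z6 where x: "x = E u n \<otimes> T z1 z2 z3 z4 z5 z6"
    using assms unfolding coords_def by blast
  have "T z1 z2 z3 z4 z5 z6 [^] p = \<one>"
    using T_pow[of z1 z2 z3 z4 z5 z6 "int p"] by (simp add: int_pow_int T_trivial_if_dvd)
  then show ?thesis
    using pow_mult_distrib[of "E u n" "T z1 z2 z3 z4 z5 z6" p] by (simp add: x T_commute[of "E _ _"] T_commute[of "w [^] _"] E_pow_p)
qed

lemma coords_center_iff:
  assumes "coords x u n"
  shows "x \<in> center G \<longleftrightarrow> (\<forall>i. int p dvd u i) \<and> int p dvd n"
proof
  assume x: "x \<in> center G"
  \<comment> \<open>Two test elements suffice: \<open>[x,a]\<close> has the entries
    \<open>- u B\<close>, \<open>- u C\<close>, \<open>- u D\<close> and \<open>n\<close>, and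
    \<open>[x,b]\<close> adds \<open>u A\<close>.\<close>
  have "commutator G x a = \<one>" "commutator G x b = \<one>"
    using centerD[OF x] coords_closed[OF assms] by (simp_all add: commutator_eq_one_iff)
  then have "int p dvd u A" "int p dvd u B" "int p dvd u C" "int p dvd u D" "int p dvd n"
    by (simp_all add: coords_commutator[OF assms coords_gens(1)] coords_commutator[OF assms coords_gens(2)] T_eq_one_iff)
  then show "(\<forall>i. int p dvd u i) \<and> int p dvd n"
    by (metis H_gen.exhaust)
next
  assume *: "(\<forall>i. int p dvd u i) \<and> int p dvd n"
  show "x \<in> center G"
  proof (rule centerI[OF coords_closed[OF assms]])
    fix y assume y: "y \<in> carrier G"
    obtain v m where "coords y v m" using coords_exist[OF y] .
    from coords_commutator[OF assms this] have "commutator G x y = \<one>"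
      using * by (simp add: T_trivial_if_dvd)
    then show "x \<otimes> y = y \<otimes> x" using y coords_closed[OF assms] by (simp add: commutator_eq_one_iff)
  qed
qed

section \<open>The orders of \<open>H\<close> and \<open>G\<close>\<close>

lemma E_H_unique:
  assumes "E u 0 \<otimes> T z1 z2 z3 z4 z5 z6 = E v 0 \<otimes> T y1 y2 y3 y4 y5 y6"
  shows "int p dvd u i - v i"
proof -
  have ev_E: "ev (gen_word u) = E u 0" for u
    by (simp add: gen_word_def E_def term_eval_IPow)
  have "ev (Mult (gen_word u) (comm_word z1 z2 z3 z4 z5 z6)) = ev (Mult (gen_word v) (comm_word y1 y2 y3 y4 y5 y6))"
    using assms by (simp add: ev_E ev_comm_word)
  then have "pres_eq (H_relations p) (Mult (gen_word u) (comm_word z1 z2 z3 z4 z5 z6))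
      (Mult (gen_word v) (comm_word y1 y2 y3 y4 y5 y6))"
    using ev_facts(3) by blast
  from pres_eq_invariants[OF this] show ?thesis
    by (simp add: expo_gen_word expo_comm_word cong_iff_dvd_diff)
qed

lemma E_mod:
  "\<exists>z1 z2 z3 z4 z5 z6. E u 0 = E (\<lambda>i. u i mod int p) 0 \<otimes> T z1 z2 z3 z4 z5 z6"
proof -
  let ?v = "\<lambda>i. u i mod int p" and ?q = "\<lambda>i. u i div int p"
  have "coords (E ?v 0 \<otimes> E (\<lambda>i. int p * ?q i) 0) u 0"
    using coords_mult[OF coords_E[of ?v 0] coords_E[of "\<lambda>i. int p * ?q i" 0]] by simp
  then obtain y1 y2 y3 y4 y5 y6 where "E ?v 0 \<otimes> E (\<lambda>i. int p * ?q i) 0 = E u 0 \<otimes> T y1 y2 y3 y4 y5 y6"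
    unfolding coords_def by blast
  then have "E u 0 = E ?v 0 \<otimes> E (\<lambda>i. int p * ?q i) 0 \<otimes> inv (T y1 y2 y3 y4 y5 y6)"
    by (simp add: inv_solve_right)
  then show ?thesis
    by (simp add: E_def gens_pow_p m_assoc T_inv T_add) blast
qed

lemma T_mod:
  "T z1 z2 z3 z4 z5 z6 = T (z1 mod int p) (z2 mod int p) (z3 mod int p) (z4 mod int p) (z5 mod int p) (z6 mod int p)"
  by (simp add: T_eq_iff)

text \<open>Four exponents and six commutator coordinates, each reduced modulo \<open>p\<close>.
  Injectivity goes in two stages: the exponents are separated by \<open>expo\<close>, after which
  the \<open>E\<close>-factor cancels and \<open>T_eq_iff\<close> separates the rest.\<close>

lemma card_H: "card H = p ^ 10"
proof -
  let ?I = "{0..<int p}"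
  let ?f = "\<lambda>(u1, u2, u3, u4, z1, z2, z3, z4, z5, z6). E (case_H_gen u1 u2 u3 u4) 0 \<otimes> T z1 z2 z3 z4 z5 z6"
  let ?D = "?I \<times> ?I \<times> ?I \<times> ?I \<times> ?I \<times> ?I \<times> ?I \<times> ?I \<times> ?I \<times> ?I"
  have eq: "x = y" if "int p dvd x - y" "x \<in> ?I" "y \<in> ?I" for x y
    using that by (auto simp: mod_eq_dvd_iff[symmetric])
  have "bij_betw ?f ?D H"
    unfolding bij_betw_def
  proof
    show "inj_on ?f ?D"
    proof (rule inj_onI)
      fix s t assume "s \<in> ?D" "t \<in> ?D" and st: "?f s = ?f t"
      then obtain u1 u2 u3 u4 z1 z2 z3 z4 z5 z6 v1 v2 v3 v4 y1 y2 y3 y4 y5 y6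
        where s: "s = (u1, u2, u3, u4, z1, z2, z3, z4, z5, z6)" and t: "t = (v1, v2, v3, v4, y1, y2, y3, y4, y5, y6)"
        by (metis prod_cases5 prod_cases6)
      have I: "u1 \<in> ?I" "u2 \<in> ?I" "u3 \<in> ?I" "u4 \<in> ?I" "z1 \<in> ?I" "z2 \<in> ?I" "z3 \<in> ?I" "z4 \<in> ?I" "z5 \<in> ?I" "z6 \<in> ?I"
        "v1 \<in> ?I" "v2 \<in> ?I" "v3 \<in> ?I" "v4 \<in> ?I" "y1 \<in> ?I" "y2 \<in> ?I" "y3 \<in> ?I" "y4 \<in> ?I" "y5 \<in> ?I" "y6 \<in> ?I"
        using \<open>s \<in> ?D\<close> \<open>t \<in> ?D\<close> by (simp_all add: s t)
      have E: "E (case_H_gen u1 u2 u3 u4) 0 \<otimes> T z1 z2 z3 z4 z5 z6 = E (case_H_gen v1 v2 v3 v4) 0 \<otimes> T y1 y2 y3 y4 y5 y6"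
        using st by (simp add: s t)
      have u: "u1 = v1" "u2 = v2" "u3 = v3" "u4 = v4"
        using E_H_unique[OF E, of A] E_H_unique[OF E, of B] E_H_unique[OF E, of C] E_H_unique[OF E, of D]
          eq[OF _ I(1) I(11)] eq[OF _ I(2) I(12)] eq[OF _ I(3) I(13)] eq[OF _ I(4) I(14)]
        by simp_all
      then have "T z1 z2 z3 z4 z5 z6 = T y1 y2 y3 y4 y5 y6"
        using E by simp
      then have "z1 = y1" "z2 = y2" "z3 = y3" "z4 = y4" "z5 = y5" "z6 = y6"
        using eq[OF _ I(5) I(15)] eq[OF _ I(6) I(16)] eq[OF _ I(7) I(17)]
          eq[OF _ I(8) I(18)] eq[OF _ I(9) I(19)] eq[OF _ I(10) I(20)]
        by (simp_all add: T_eq_iff)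
      with u show "s = t" by (simp add: s t)
    qed
    show "?f ` ?D = H"
    proof
      have "E u 0 \<in> H" for u
        unfolding E_def using gens_H subgroup_H
        by (simp add: subgroup.m_closed subgroup_int_pow_closed)
      then show "?f ` ?D \<subseteq> H"
        using subgroup_H T_H by (auto simp: subgroup.m_closed)
      show "H \<subseteq> ?f ` ?D"
      proof
        fix x assume "x \<in> H"
        then obtain u where "coords x u 0" by (rule coords_H)
        then obtain z1 z2 z3 z4 z5 z6 where x: "x = E u 0 \<otimes> T z1 z2 z3 z4 z5 z6"
          unfolding coords_def by blast
        obtain y1 y2 y3 y4 y5 y6 where y: "E u 0 = E (\<lambda>i. u i mod int p) 0 \<otimes> T y1 y2 y3 y4 y5 y6"
          using E_mod[of u] by blast
        have "E (\<lambda>i. u i mod int p) 0 = E (case_H_gen (u A mod int p) (u B mod int p) (u C mod int p) (u D mod int p)) 0"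
          by (simp add: E_def)
        then have "x = E (case_H_gen (u A mod int p) (u B mod int p) (u C mod int p) (u D mod int p)) 0
            \<otimes> T (y1 + z1) (y2 + z2) (y3 + z3) (y4 + z4) (y5 + z5) (y6 + z6)"
          by (simp add: x y m_assoc T_add)
        also have "\<dots> = ?f (u A mod int p, u B mod int p, u C mod int p, u D mod int p, (y1 + z1) mod int p, (y2 + z2) mod int p,
            (y3 + z3) mod int p, (y4 + z4) mod int p, (y5 + z5) mod int p, (y6 + z6) mod int p)"
          by (simp add: T_mod[symmetric])
        finally show "x \<in> ?f ` ?D"
          by (rule image_eqI) (simp add: p_pos)
      qed
    qed
  qed
  then have "card H = card ?D" by (rule bij_betw_same_card[symmetric])
  also have "\<dots> = p ^ 10" by (simp add: card_cartesian_product power_numeral_reduce)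
  finally show ?thesis .
qed

text \<open>The powers of \<open>w\<close> with exponents below \<open>p^2\<close> represent the
  cosets of \<open>H\<close>, since \<open>w [^] n\<close> lies in \<open>H\<close> exactly when
  \<open>p^2\<close> divides \<open>n\<close>.\<close>

lemma order_G: "order G = p ^ 12"
proof -
  let ?f = "\<lambda>(h, n). h \<otimes> w [^] n" and ?J = "{0..<int p ^ 2}"
  have "bij_betw ?f (H \<times> ?J) (carrier G)"
    unfolding bij_betw_def
  proof
    show "inj_on ?f (H \<times> ?J)"
    proof (rule inj_onI, clarify)
      fix h k n m assume h: "h \<in> H" and k: "k \<in> H" and nm: "n \<in> ?J" "m \<in> ?J" and eq: "h \<otimes> w [^] n = k \<otimes> w [^] m"
      have "inv k \<otimes> (h \<otimes> w [^] n) \<otimes> inv (w [^] n) = inv k \<otimes> h"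
        using H_closed[OF h] H_closed[OF k] by (simp add: m_assoc)
      then have "inv k \<otimes> h = inv k \<otimes> (k \<otimes> w [^] m) \<otimes> inv (w [^] n)"
        by (simp add: eq)
      also have "\<dots> = w [^] (m - n)"
        using H_closed[OF k] by (simp add: int_pow_diff flip: m_assoc)
      finally have "w [^] (m - n) \<in> H"
        using h k subgroup_H by (metis subgroup.m_closed subgroup.m_inv_closed)
      then have "n = m"
        using nm by (auto simp: w_pow_H_iff mod_eq_dvd_iff[symmetric])
      then show "h = k \<and> n = m"
        using eq H_closed h k by simp
    qed
    show "?f ` (H \<times> ?J) = carrier G"
    proof
      show "?f ` (H \<times> ?J) \<subseteq> carrier G" using H_closed by auto
      show "carrier G \<subseteq> ?f ` (H \<times> ?J)"
      proof
        fix x assume "x \<in> carrier G"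
        then obtain h n where h: "h \<in> H" and x: "x = h \<otimes> w [^] (n::int)"
          using carrier_form by blast
        have "w [^] (int p ^ 2 * (n div int p ^ 2)) \<in> H" by (simp add: w_pow_H_iff)
        moreover have "x = h \<otimes> w [^] (int p ^ 2 * (n div int p ^ 2)) \<otimes> w [^] (n mod int p ^ 2)"
          using H_closed[OF h] by (simp add: x m_assoc int_pow_mult[symmetric])
        ultimately have "x = ?f (h \<otimes> w [^] (int p ^ 2 * (n div int p ^ 2)), n mod int p ^ 2)"
          "h \<otimes> w [^] (int p ^ 2 * (n div int p ^ 2)) \<in> H"
          using h subgroup_H by (simp_all add: subgroup.m_closed)
        then show "x \<in> ?f ` (H \<times> ?J)"
          by (intro image_eqI[of _ _ "(h \<otimes> w [^] (int p ^ 2 * (n div int p ^ 2)), n mod int p ^ 2)"]) (simp_all add: p_pos)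
      qed
    qed
  qed
  then have "card (carrier G) = card (H \<times> ?J)" by (rule bij_betw_same_card[symmetric])
  also have "\<dots> = p ^ 10 * p ^ 2"
    by (simp add: card_cartesian_product card_H nat_power_eq)
  finally show ?thesis by (simp add: order_def flip: power_add)
qed

lemma w_conj_H:
  assumes "coords x u 0"
  shows "w \<otimes> x \<otimes> inv w = x \<otimes> T 0 0 0 0 (u A) 0"
proof -
  have x: "x \<in> carrier G" using assms by (rule coords_closed)
  have "commutator G w x = T 0 0 0 0 (u A) 0"
    using coords_commutator[OF coords_gens(5) assms] by simp
  then have "w \<otimes> x = x \<otimes> T 0 0 0 0 (u A) 0 \<otimes> w"
    using commutator_swap[OF w_closed x] x by (simp add: T_left_commute[of x] m_assoc)
  then show ?thesis
    using x by (simp add: inv_solve_right')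
qed

lemma central_automorphism_w: "central_automorphism (G\<lparr>carrier := H\<rparr>) (\<lambda>h\<in>H. w \<otimes> h \<otimes> inv w)"
proof -
  let ?K = "G\<lparr>carrier := H\<rparr>"
  interpret K: group ?K using subgroup_H by (rule subgroup_imp_group)
  have "center ?K #>\<^bsub>?K\<^esub> (w \<otimes> x \<otimes> inv w) = center ?K #>\<^bsub>?K\<^esub> x" if x: "x \<in> H" for x
  proof -
    obtain u where u: "coords x u 0" using coords_H[OF x] .
    let ?t = "T 0 0 0 0 (u A) 0"
    have t: "?t \<in> center ?K"
      by (rule centerI) (simp_all add: T_H T_commute H_closed)
    have "w \<otimes> x \<otimes> inv w = ?t \<otimes> x"
      using w_conj_H[OF u] H_closed[OF x] by (simp add: T_commute[of x])
    then have "w \<otimes> x \<otimes> inv w \<in> center ?K #>\<^bsub>?K\<^esub> x"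
      using t by (auto simp: r_coset_def)
    then show ?thesis
      using K.repr_independence[OF _ _ K.center_subgroup] x by simp
  qed
  then show ?thesis
    using conjugation_auto[OF normal_H w_closed] by (simp add: central_automorphism_def)
qed

lemma not_inner_w: "\<not> inner_automorphism (G\<lparr>carrier := H\<rparr>) (\<lambda>h\<in>H. w \<otimes> h \<otimes> inv w)"
proof
  assume "inner_automorphism (G\<lparr>carrier := H\<rparr>) (\<lambda>h\<in>H. w \<otimes> h \<otimes> inv w)"
  then obtain g where g: "g \<in> H"
    and eq: "(\<lambda>h\<in>H. w \<otimes> h \<otimes> inv w) = (\<lambda>h\<in>H. g \<otimes> h \<otimes> inv g)"
    by (auto simp: inner_automorphism_def m_inv_consistent[OF subgroup_H])
  have conj: "w \<otimes> h \<otimes> inv w = g \<otimes> h \<otimes> inv g" if "h \<in> H" for h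
    using fun_cong[OF eq, of h] that by simp
  obtain u where u: "coords g u 0" using coords_H[OF g] .
  \<comment> \<open>An element of \<open>H\<close> inducing this action centralizes \<open>b\<close>
    and \<open>c\<close>, and these two commutators detect all four exponents. So \<open>g\<close>
    is central and fixes \<open>a\<close>, although \<open>w\<close> moves \<open>a\<close> by
    \<open>[b,d]\<close>.\<close>
  have "commutator G g b = \<one>" "commutator G g c = \<one>"
    using conj[of b] conj[of c] gens_H H_closed[OF g] by (simp_all add: commutator_eq_one_iff wb wc inv_solve_right')
      (metis gens_closed inv_solve_right m_closed)+
  then have "int p dvd u A" "int p dvd u B" "int p dvd u C" "int p dvd u D"
    by (simp_all add: coords_commutator[OF u coords_gens(2)] coords_commutator[OF u coords_gens(3)] T_eq_one_iff)
  then have "g \<in> center G"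
    using coords_center_iff[OF u] by (metis H_gen.exhaust dvd_0_right)
  then have "g \<otimes> a \<otimes> inv g = a"
    using H_closed[OF g] centerD[of g G a] by (simp add: m_assoc)
  then have "a \<otimes> d [^] p = a"
    using conj[of a] gens_H by (simp add: wa)
  then have "T 0 0 0 0 1 0 = \<one>" by (simp add: powers_T)
  then show False using prime by (auto simp: T_eq_one_iff)
qed

lemma w_pow_p_center: "w [^] int p \<in> center G"
  using coords_center_iff[OF coords_int_pow[OF coords_gens(5), of "int p"]] by simp

text \<open>The witness is \<open>w^p\<close>: it is central, but the derived subgroup lies in
  \<open>H\<close>, where \<open>w^p\<close> does not.\<close>

lemma not_special: "\<not> special_p_group p G"
proof
  assume "special_p_group p G"
  then have "w [^] int p \<in> derived G (carrier G)"
    using w_pow_p_center by (simp add: special_p_group_def)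
  moreover have "derived G (carrier G) \<subseteq> H"
    unfolding derived_def
  proof (rule generate_subgroup_incl[OF _ subgroup_H], clarsimp)
    fix x y assume xy: "x \<in> carrier G" "y \<in> carrier G"
    obtain u n v m where "coords x u n" "coords y v m"
      using coords_exist xy by meson
    from coords_commutator[OF this] show "x \<otimes> y \<otimes> inv x \<otimes> inv y \<in> H"
      using T_H by (simp add: commutator_def)
  qed
  ultimately have "int p ^ 2 dvd int p" by (auto simp: w_pow_H_iff)
  then have "int p dvd 1"
    using p_pos by (simp add: power2_eq_square)
  then show False using prime by auto
qed

lemma not_comm: "\<not> comm_group G"
proof
  assume "comm_group G"
  then interpret comm_group G .
  have "T 1 0 0 0 0 0 = \<one>"
    using coords_commutator[OF coords_gens(1,2)] commutator_eq_one_iff[of a b] m_comm[of a b] by simp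
  then show False using prime by (auto simp: T_eq_one_iff)
qed

lemma subgroup_with_gens:
  assumes "subgroup K G" "a \<in> K" "b \<in> K" "c \<in> K" "d \<in> K" "w \<in> K"
  shows "K = carrier G"
proof
  show "K \<subseteq> carrier G" using assms(1) by (rule subgroup.subset)
  show "carrier G \<subseteq> K"
  proof
    fix x assume "x \<in> carrier G"
    then obtain s n where x: "x = ev s \<otimes> w [^] (n::int)"
      using carrier_form ev_facts(2) by (metis imageE)
    have "ev s \<in> K"
      by (rule term_eval_in_subgroup[OF assms(1)]) (use assms in \<open>simp split: H_gen.split\<close>)
    then show "x \<in> K"
      using x assms by (simp add: subgroup.m_closed subgroup_int_pow_closed)
  qed
qed

lemma hom_eq_on_gens:
  assumes f: "f \<in> hom G G" and g: "g \<in> hom G G"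
    and eq: "f a = g a" "f b = g b" "f c = g c" "f d = g d" "f w = g w" and x: "x \<in> carrier G"
  shows "f x = g x"
proof -
  interpret f: group_hom G G f by (rule group_hom.intro) (use f in \<open>simp_all add: group_hom_axioms_def is_group\<close>)
  interpret g: group_hom G G g by (rule group_hom.intro) (use g in \<open>simp_all add: group_hom_axioms_def is_group\<close>)
  have "subgroup {x \<in> carrier G. f x = g x} G"
    by (rule subgroupI) (auto intro: exI[of _ \<one>])
  then have "{x \<in> carrier G. f x = g x} = carrier G"
    by (rule subgroup_with_gens) (simp_all add: eq)
  then show ?thesis using x by blast
qed

section \<open>Automorphisms of \<open>G\<close>\<close>

lemma center_form:
  assumes "z \<in> center G" and M: "w [^] (int p ^ 2) = T m1 m2 m3 m4 m5 m6"
  obtains z1 z2 z3 z4 z5 z6 j where "z = T z1 z2 z3 z4 z5 z6 \<otimes> w [^] (int p * j)"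
proof -
  obtain u n where u: "coords z u n" using coords_exist[OF center_carrier[OF assms(1)]] .
  then have dvd: "\<And>i. int p dvd u i" "int p dvd n"
    using coords_center_iff assms(1) by blast+
  obtain z1 z2 z3 z4 z5 z6 where z: "z = E u n \<otimes> T z1 z2 z3 z4 z5 z6"
    using u unfolding coords_def by blast
  obtain k1 k2 k3 k4 j where "u A = int p * k1" "u B = int p * k2" "u C = int p * k3" "u D = int p * k4" "n = int p * j"
    using dvd by (metis dvdE)
  then have "z = T (k2 + z1) (k1 + k2 + z2) (k2 + z3) (k3 + z4) (k3 + k4 + z5) z6 \<otimes> w [^] (int p * j)"
    by (simp add: z E_def gens_pow_p T_add T_add_assoc m_assoc T_commute[of "w [^] _", symmetric] add.assoc add.commute add.left_commute)
  then show ?thesis by (rule that)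
qed

lemma commutators_fixed:
  assumes f: "group_hom G G f"
    and gens: "\<And>x. x \<in> {a, b, c, d} \<Longrightarrow> \<exists>\<zeta> \<in> center G. f x = x \<otimes> \<zeta>"
  shows "f (T z1 z2 z3 z4 z5 z6) = T z1 z2 z3 z4 z5 z6"
proof -
  interpret f: group_hom G G f by (rule f)
  have *: "f (commutator G x y) = commutator G x y" if xy: "x \<in> {a, b, c, d}" "y \<in> {a, b, c, d}" for x y
  proof -
    obtain \<zeta> \<eta> where "\<zeta> \<in> center G" "f x = x \<otimes> \<zeta>" "\<eta> \<in> center G" "f y = y \<otimes> \<eta>"
      using gens xy by meson
    moreover have "x \<in> carrier G" "y \<in> carrier G" using xy by auto
    ultimately show ?thesis
      using f.hom_commutator[of x y]
      by (simp add: commutator_center_mult_left commutator_center_mult_right center_carrier)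
  qed
  show ?thesis
    by (simp add: T_def f.hom_int_pow *)
qed

text \<open>For a generator \<open>x\<close> of \<open>H\<close>, the element \<open>x^p\<close> is
  a product of commutators and thus fixed, so the central factor satisfies
  \<open>\<zeta>^p = 1\<close>. As \<open>w\<close> has order \<open>p^3\<close>, the exponent of
  \<open>w\<close> in \<open>\<zeta>\<close> is a multiple of \<open>p^2\<close>, and by
  \<open>M\<close> that power of \<open>w\<close> is again a \<open>T\<close>.\<close>

lemma central_auto_form:
  assumes f: "group_hom G G f"
    and M: "w [^] (int p ^ 2) = T m1 m2 m3 m4 m5 m6"
    and gens: "\<And>x. x \<in> {a, b, c, d, w} \<Longrightarrow> \<exists>\<zeta> \<in> center G. f x = x \<otimes> \<zeta>"
  shows "x \<in> {a, b, c, d} \<Longrightarrow> \<exists>z1 z2 z3 z4 z5 z6. f x = x \<otimes> T z1 z2 z3 z4 z5 z6"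
    and "\<exists>z1 z2 z3 z4 z5 z6 j. f w = T z1 z2 z3 z4 z5 z6 \<otimes> w [^] (1 + int p * j)"
proof -
  interpret f: group_hom G G f by (rule f)
  have fT: "f (T z1 z2 z3 z4 z5 z6) = T z1 z2 z3 z4 z5 z6" for z1 z2 z3 z4 z5 z6
    using commutators_fixed[OF f] gens by blast
  show "\<exists>z1 z2 z3 z4 z5 z6. f x = x \<otimes> T z1 z2 z3 z4 z5 z6" if x: "x \<in> {a, b, c, d}"
  proof -
    have xG: "x \<in> carrier G" using x by auto
    obtain \<zeta> where \<zeta>: "\<zeta> \<in> center G" and fx: "f x = x \<otimes> \<zeta>" using gens x by blast
    obtain z1 z2 z3 z4 z5 z6 j where z: "\<zeta> = T z1 z2 z3 z4 z5 z6 \<otimes> w [^] (int p * j)"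
      using center_form[OF \<zeta> M] .
    have "f (x [^] p) = x [^] p"
      using x by (auto simp: powers_T fT)
    then have "x [^] p = x [^] p \<otimes> \<zeta> [^] p"
      using xG center_carrier[OF \<zeta>] pow_mult_distrib[OF centerD[OF \<zeta> xG, symmetric], of p]
      by (simp add: f.hom_nat_pow fx)
    then have "\<zeta> [^] p = \<one>"
      using xG center_carrier[OF \<zeta>] by (metis l_cancel_one' nat_pow_closed)
    moreover have "\<zeta> [^] p = w [^] (int p ^ 2 * j)"
    proof -
      have "coords (w [^] (int p * j)) (\<lambda>_. 0) (int p * j)"
        using coords_int_pow[OF coords_gens(5), of "int p * j"] by simp
      from coords_mult[OF coords_T this] have "coords \<zeta> (\<lambda>_. 0) (int p * j)"
        unfolding z by simp
      from coords_pow_p[OF this] show ?thesis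
        by (simp add: power2_eq_square mult.assoc)
    qed
    ultimately have "int p ^ 3 dvd int p ^ 2 * j"
      by (simp add: w_pow_eq_one_iff)
    then have "int p dvd j"
      using p_pos by (simp add: power3_eq_cube power2_eq_square)
    then obtain l where "j = int p * l" by (rule dvdE)
    then have "w [^] (int p * j) = (w [^] (int p ^ 2)) [^] l"
      by (simp add: int_pow_pow power2_eq_square mult.assoc)
    then show ?thesis
      unfolding fx z M by (simp add: T_pow T_add) blast
  qed
  obtain \<zeta> where \<zeta>: "\<zeta> \<in> center G" and fw: "f w = w \<otimes> \<zeta>" using gens by blast
  obtain z1 z2 z3 z4 z5 z6 j where z: "\<zeta> = T z1 z2 z3 z4 z5 z6 \<otimes> w [^] (int p * j)"
    using center_form[OF \<zeta> M] .
  have "f w = T z1 z2 z3 z4 z5 z6 \<otimes> w [^] (1 + int p * j)"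
    by (simp add: fw z int_pow_mult T_left_commute[of w])
  then show "\<exists>z1 z2 z3 z4 z5 z6 j. f w = T z1 z2 z3 z4 z5 z6 \<otimes> w [^] (1 + int p * j)"
    by blast
qed

lemma central_autos_commute:
  assumes fg: "group_hom G G f" "group_hom G G g"
    and M: "w [^] (int p ^ 2) = T m1 m2 m3 m4 m5 m6"
    and gens: "\<And>x. x \<in> {a, b, c, d, w} \<Longrightarrow> \<exists>\<zeta> \<in> center G. f x = x \<otimes> \<zeta>"
      "\<And>x. x \<in> {a, b, c, d, w} \<Longrightarrow> \<exists>\<zeta> \<in> center G. g x = x \<otimes> \<zeta>"
    and x: "x \<in> carrier G"
  shows "f (g x) = g (f x)"
proof -
  interpret f: group_hom G G f by (rule fg)
  interpret g: group_hom G G g by (rule fg)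
  have fT: "f (T z1 z2 z3 z4 z5 z6) = T z1 z2 z3 z4 z5 z6" and gT: "g (T z1 z2 z3 z4 z5 z6) = T z1 z2 z3 z4 z5 z6"
    for z1 z2 z3 z4 z5 z6
    using commutators_fixed fg gens by blast+
  note f_form = central_auto_form[OF fg(1) M gens(1)]
  note g_form = central_auto_form[OF fg(2) M gens(2)]
  have H_gens: "f (g x) = g (f x)" if x: "x \<in> {a, b, c, d}" for x
  proof -
    have "x \<in> carrier G" using x by auto
    moreover obtain z1 z2 z3 z4 z5 z6 where "f x = x \<otimes> T z1 z2 z3 z4 z5 z6" using f_form(1)[OF _ x] by blast
    moreover obtain y1 y2 y3 y4 y5 y6 where "g x = x \<otimes> T y1 y2 y3 y4 y5 y6" using g_form(1)[OF _ x] by blast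
    ultimately show ?thesis by (simp add: fT gT m_assoc T_add add.commute)
  qed
  have "f (g w) = g (f w)"
  proof -
    obtain z1 z2 z3 z4 z5 z6 j where f: "f w = T z1 z2 z3 z4 z5 z6 \<otimes> w [^] (1 + int p * j)" using f_form(2) by blast
    obtain y1 y2 y3 y4 y5 y6 k where g: "g w = T y1 y2 y3 y4 y5 y6 \<otimes> w [^] (1 + int p * k)" using g_form(2) by blast
    have pw: "(T z1 z2 z3 z4 z5 z6 \<otimes> w [^] m) [^] (n::int) = T z1 z2 z3 z4 z5 z6 [^] n \<otimes> w [^] (m * n)" for z1 z2 z3 z4 z5 z6 m n
      by (simp add: int_pow_mult_distrib T_commute[of "w [^] _"] int_pow_pow T_pow)
    \<comment> \<open>Every \<open>T\<close> has exponent \<open>p\<close>, so a power congruent to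
      \<open>1\<close> leaves it unchanged. What remains of the two composites on \<open>w\<close>
      is symmetric in \<open>j\<close> and \<open>k\<close>.\<close>
    have pT: "T z1 z2 z3 z4 z5 z6 [^] (1 + int p * n) = T z1 z2 z3 z4 z5 z6" for z1 z2 z3 z4 z5 z6 n
      by (simp add: T_pow T_eq_iff algebra_simps)
    show ?thesis
      unfolding f g by (simp add: fT gT f.hom_int_pow g.hom_int_pow)
        (simp add: f g pw pT T_add_assoc add.commute mult.commute[of "1 + int p * j"])
  qed
  note w_gen = this
  show ?thesis
  proof (rule hom_eq_on_gens[where f = "\<lambda>x. f (g x)" and g = "\<lambda>x. g (f x)"])
    show "(\<lambda>x. f (g x)) \<in> hom G G" "(\<lambda>x. g (f x)) \<in> hom G G"
      by (simp_all add: hom_def)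
    show "f (g a) = g (f a)" "f (g b) = g (f b)" "f (g c) = g (f c)" "f (g d) = g (f d)"
      by (rule H_gens; blast)+
  qed (fact w_gen x)+
qed

lemma generate_w_pow: "w [^] (p ^ 2) = w [^] (int p ^ 2)"
  using int_pow_int[of G w "p ^ 2"] by simp

section \<open>The case of \<open>[a,b]\<close>: every automorphism is central\<close>

lemma cyclic_generator:
  assumes "generate G {w [^] (p ^ 2)} = generate G {t}" "t \<in> carrier G"
  obtains k l where "w [^] (int p ^ 2) = t [^] (k::int)" "t = w [^] (int p ^ 2 * l)"
proof -
  let ?m = "w [^] (int p ^ 2)"
  have "?m \<in> generate G {t}" "t \<in> generate G {?m}"
    using assms generate.incl[of t "{t}" G] generate.incl[of ?m "{?m}" G] by (simp_all add: generate_w_pow)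
  then show ?thesis
    using that by (auto simp: generate_pow assms(2) int_pow_pow)
qed

lemma auto_central_if_ab:
  assumes M: "generate G {w [^] (p ^ 2)} = generate G {commutator G a b}"
    and f: "f \<in> auto G" and x: "x \<in> {a, b, c, d, w}"
  shows "\<exists>\<zeta> \<in> center G. f x = x \<otimes> \<zeta>"
proof -
  interpret f: group_hom G G f using f by (rule hom_if_auto)
  obtain k l where kl: "w [^] (int p ^ 2) = commutator G a b [^] (k::int)" "commutator G a b = w [^] (int p ^ 2 * l)"
    by (rule cyclic_generator[OF M commutator_closed[OF gens_closed(1,2)]]) (erule (1) that)
  have wk: "w [^] (int p ^ 2) = T k 0 0 0 0 0" and abl: "T 1 0 0 0 0 0 = w [^] (int p ^ 2 * l)"
    using kl T_units(1)[of k] T_units(1)[of 1] by simp_all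
  have wkn: "w [^] (int p * (int p * n)) = T (k * n) 0 0 0 0 0" for n
  proof -
    have "w [^] (int p * (int p * n)) = (w [^] (int p ^ 2)) [^] n"
      by (simp add: int_pow_pow power2_eq_square mult.assoc)
    then show ?thesis by (simp add: wk T_pow mult.commute)
  qed
  obtain \<alpha> n1 where fa: "coords (f a) \<alpha> n1" using coords_exist[of "f a"] by auto
  obtain \<beta> n2 where fb: "coords (f b) \<beta> n2" using coords_exist[of "f b"] by auto
  obtain \<gamma> n3 where fc: "coords (f c) \<gamma> n3" using coords_exist[of "f c"] by auto
  obtain \<delta> n4 where fd: "coords (f d) \<delta> n4" using coords_exist[of "f d"] by auto
  obtain \<omega> m where fw: "coords (f w) \<omega> m" using coords_exist[of "f w"] by auto
  note comm = coords_commutator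
  \<comment> \<open>The commutator \<open>y^p\<close> lies in \<open>H\<close>, hence so does the
    factor \<open>w^(p * n)\<close>, which forces \<open>p\<close> to divide \<open>n\<close>. The
    resulting power of \<open>w^(p^2)\<close> adds \<open>k * n'\<close> to the
    \<open>[a,b]\<close>-entry and to no other.\<close>
  have power: "\<exists>n'. n = int p * n' \<and> y [^] p = T (u B + k * n') (u A + u B) (u B) (u C) (u C + u D) 0"
    if y: "coords y u n" and z: "y [^] p = commutator G y1 y2" and y12: "y1 \<in> carrier G" "y2 \<in> carrier G" for y u n y1 y2
  proof -
    have yp: "y [^] p = T (u B) (u A + u B) (u B) (u C) (u C + u D) 0 \<otimes> w [^] (int p * n)"
      using coords_pow_p[OF y] .
    obtain u1 m1 u2 m2 where "coords y1 u1 m1" "coords y2 u2 m2"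
      using coords_exist y12 by meson
    from comm[OF this] have "y [^] p \<in> H"
      using z T_H by simp
    moreover have "w [^] (int p * n) = inv (T (u B) (u A + u B) (u B) (u C) (u C + u D) 0) \<otimes> y [^] p"
      by (simp add: yp flip: m_assoc)
    ultimately have "w [^] (int p * n) \<in> H"
      using T_H subgroup_H by (simp add: subgroup.m_closed subgroup.m_inv_closed)
    then have "int p dvd n"
      using p_pos by (simp add: w_pow_H_iff power2_eq_square)
    then obtain n' where "n = int p * n'" by (rule dvdE)
    then show ?thesis using yp by (auto simp: wkn T_add)
  qed
  have fbcd: "coords (f (b \<otimes> c \<otimes> d)) (\<lambda>i. \<beta> i + \<gamma> i + \<delta> i) (n2 + n3 + n4)"
    using coords_mult[OF coords_mult[OF fb fc] fd] by simp
  have fcd: "coords (f (c \<otimes> d)) (\<lambda>i. \<gamma> i + \<delta> i) (n3 + n4)"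
    using coords_mult[OF fc fd] by simp
  have fp: "f a [^] p = commutator G (f a) (f c)" "f b [^] p = commutator G (f a) (f (b \<otimes> c \<otimes> d))"
    "f c [^] p = commutator G (f b) (f (c \<otimes> d))" "f d [^] p = commutator G (f b) (f d)"
    by (simp_all only: f.hom_nat_pow[symmetric] f.hom_commutator[symmetric] power_relations gens_closed m_closed)
  obtain k1 where n1: "n1 = int p * k1" and pa: "f a [^] p = T (\<alpha> B + k * k1) (\<alpha> A + \<alpha> B) (\<alpha> B) (\<alpha> C) (\<alpha> C + \<alpha> D) 0"
    using power[OF fa fp(1)] by auto
  obtain k2 where n2: "n2 = int p * k2" and pb: "f b [^] p = T (\<beta> B + k * k2) (\<beta> A + \<beta> B) (\<beta> B) (\<beta> C) (\<beta> C + \<beta> D) 0"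
    using power[OF fb fp(2)] by auto
  obtain k3 where n3: "n3 = int p * k3" and pc: "f c [^] p = T (\<gamma> B + k * k3) (\<gamma> A + \<gamma> B) (\<gamma> B) (\<gamma> C) (\<gamma> C + \<gamma> D) 0"
    using power[OF fc fp(3)] by auto
  obtain k4 where n4: "n4 = int p * k4" and pd: "f d [^] p = T (\<delta> B + k * k4) (\<delta> A + \<delta> B) (\<delta> B) (\<delta> C) (\<delta> C + \<delta> D) 0"
    using power[OF fd fp(4)] by auto
  have "commutator G w b = \<one>" "commutator G w c = \<one>" "commutator G w d = \<one>"
    by (simp_all add: commutator_eq_one_iff w_commute)
  then have W: "commutator G (f w) (f b) = \<one>" "commutator G (f w) (f c) = \<one>" "commutator G (f w) (f d) = \<one>"
    by (simp_all flip: f.hom_commutator)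
  have "commutator G w a = commutator G b d"
    by (simp add: comm[OF coords_gens(5,1)] comm[OF coords_gens(2,4)])
  then have Wa: "commutator G (f b) (f d) = commutator G (f w) (f a)"
    by (simp flip: f.hom_commutator)
  \<comment> \<open>The image of \<open>[a,b] = w^(p^2 * l)\<close> is obtained by raising
    \<open>f w\<close> to the power \<open>p\<close> twice: the first time leaves a \<open>T\<close>
    and \<open>w^(p * m)\<close>, the second time kills the \<open>T\<close>. The outcome is the
    \<open>m\<close>-th power of \<open>[a,b]\<close>.\<close>
  have ab: "commutator G (f a) (f b) = T m 0 0 0 0 0"
  proof -
    have "commutator G (f a) (f b) = f (w [^] (int p ^ 2 * l))"
      by (simp add: abl[symmetric] comm[OF coords_gens(1,2)] flip: f.hom_commutator)
    also have "\<dots> = ((f w [^] p) [^] int p) [^] l"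
      by (simp add: f.hom_int_pow int_pow_pow power2_eq_square flip: int_pow_int)
    also have "f w [^] p = T (\<omega> B) (\<omega> A + \<omega> B) (\<omega> B) (\<omega> C) (\<omega> C + \<omega> D) 0 \<otimes> w [^] (int p * m)"
      using coords_pow_p[OF fw] .
    also have "\<dots> [^] int p = (w [^] (int p * m)) [^] int p"
      by (simp add: int_pow_mult_distrib T_commute[of "w [^] _"] T_pow T_trivial_if_dvd)
    also have "\<dots> [^] l = (w [^] (int p ^ 2 * l)) [^] m"
      by (simp add: int_pow_pow power2_eq_square mult.commute mult.left_commute)
    also have "\<dots> = T m 0 0 0 0 0"
      by (simp add: abl[symmetric] T_pow)
    finally show ?thesis .
  qed
  \<comment> \<open>A row relation with coefficients \<open>r1\<close> to \<open>r5\<close> says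
    that the element with these exponents has a central image. Then the element itself is central,
    which means that all its exponents are divisible by \<open>p\<close>.\<close>
  have independent: "int p dvd r1 \<and> int p dvd r2 \<and> int p dvd r3 \<and> int p dvd r4 \<and> int p dvd r5"
    if r: "\<And>i. int p dvd r1 * \<alpha> i + r2 * \<beta> i + r3 * \<gamma> i + r4 * \<delta> i + r5 * \<omega> i"
      and n: "int p dvd r1 * n1 + r2 * n2 + r3 * n3 + r4 * n4 + r5 * m" for r1 r2 r3 r4 r5
  proof -
    let ?x = "E (case_H_gen r1 r2 r3 r4) r5"
    have fx: "f ?x = f a [^] r1 \<otimes> f b [^] r2 \<otimes> f c [^] r3 \<otimes> f d [^] r4 \<otimes> f w [^] r5"
      by (simp add: E_def f.hom_int_pow m_assoc)
    have "coords (f ?x) (\<lambda>i. r1 * \<alpha> i + r2 * \<beta> i + r3 * \<gamma> i + r4 * \<delta> i + r5 * \<omega> i)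
        (r1 * n1 + r2 * n2 + r3 * n3 + r4 * n4 + r5 * m)"
      unfolding fx by (intro coords_mult coords_int_pow fa fb fc fd fw)
    then have "f ?x \<in> center G"
      using coords_center_iff r n by blast
    then have "?x \<in> center G"
      using auto_center_imp[OF f] by simp
    then have "(\<forall>i. int p dvd case_H_gen r1 r2 r3 r4 i) \<and> int p dvd r5"
      using coords_center_iff[OF coords_E] by blast
    then show ?thesis
      by (metis H_gen.case)
  qed
  note eqs = W[unfolded comm[OF fw fb] comm[OF fw fc] comm[OF fw fd] T_eq_one_iff]
    Wa[unfolded comm[OF fw fa] comm[OF fb fd] T_eq_iff] ab[unfolded comm[OF fa fb] T_eq_iff]
    fp[unfolded pa pb pc pd comm[OF fa fc] comm[OF fa fbcd] comm[OF fb fcd] comm[OF fb fd], THEN HOL.sym, unfolded T_eq_iff]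
  have ndvd: "int p dvd n1" "int p dvd n2" "int p dvd n3" "int p dvd n4"
    by (simp_all add: n1 n2 n3 n4)
  have *: "(\<forall>i. int p dvd \<alpha> i - case_H_gen 1 0 0 0 i) \<and> (\<forall>i. int p dvd \<beta> i - case_H_gen 0 1 0 0 i) \<and>
      (\<forall>i. int p dvd \<gamma> i - case_H_gen 0 0 1 0 i) \<and> (\<forall>i. int p dvd \<delta> i - case_H_gen 0 0 0 1 i) \<and>
      (\<forall>i. int p dvd \<omega> i) \<and> int p dvd m - 1"
    by (rule rigid_solution[OF prime_int ndvd independent]) (use eqs in simp_all)
  have central: "\<exists>\<zeta> \<in> center G. f y = y \<otimes> \<zeta>"
    if y: "coords y u n" and fy: "coords (f y) v l" and d: "\<forall>i. int p dvd v i - u i" "int p dvd l - n" for y u n v l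
  proof -
    have yc: "y \<in> carrier G" "f y \<in> carrier G" using coords_closed y fy by blast+
    have "coords (inv y \<otimes> f y) (\<lambda>i. - u i + v i) (- n + l)"
      using coords_mult[OF coords_inv[OF y] fy] .
    then have "inv y \<otimes> f y \<in> center G"
      using coords_center_iff d by (simp add: add.commute)
    moreover have "f y = y \<otimes> (inv y \<otimes> f y)"
      using yc by (simp flip: m_assoc)
    ultimately show ?thesis by blast
  qed
  show ?thesis
    using x central[OF coords_gens(1) fa] central[OF coords_gens(2) fb] central[OF coords_gens(3) fc]
      central[OF coords_gens(4) fd] central[OF coords_gens(5) fw] * ndvd by auto
qed

lemma miller_if_ab:
  assumes M: "generate G {w [^] (p ^ 2)} = generate G {commutator G a b}"
  shows "miller_group G"
proof -
  obtain k l where kl: "w [^] (int p ^ 2) = commutator G a b [^] (k::int)" "commutator G a b = w [^] (int p ^ 2 * l)"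
    by (rule cyclic_generator[OF M commutator_closed[OF gens_closed(1,2)]]) (erule (1) that)
  have wk: "w [^] (int p ^ 2) = T k 0 0 0 0 0"
    using kl(1) T_units(1)[of k] by simp
  note commute = central_autos_commute[OF _ _ wk]
  have "\<forall>f \<in> auto G. \<forall>g \<in> auto G. \<forall>x \<in> carrier G. f (g x) = g (f x)"
  proof (intro ballI)
    fix f g x assume "f \<in> auto G" "g \<in> auto G" "x \<in> carrier G"
    then show "f (g x) = g (f x)"
      by (intro commute hom_if_auto auto_central_if_ab[OF M])
  qed
  then show ?thesis
    using not_comm by (simp add: miller_group_def is_group comm_AutoGroup_iff)
qed

section \<open>The case of \<open>[a,d]\<close>: a non-central automorphism\<close>

lemma not_miller_if_ad:
  assumes M: "generate G {w [^] (p ^ 2)} = generate G {commutator G a d}"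
  shows "\<not> miller_group G"
proof -
  obtain k l where kl: "w [^] (int p ^ 2) = commutator G a d [^] (k::int)" "commutator G a d = w [^] (int p ^ 2 * l)"
    by (rule cyclic_generator[OF M commutator_closed[OF gens_closed(1,4)]]) (erule (1) that)
  have wk: "w [^] (int p ^ 2) = T 0 0 k 0 0 0"
    using kl(1) T_units(3)[of k] by simp
  have k: "\<not> int p dvd k"
  proof
    assume "int p dvd k"
    then have "w [^] (int p ^ 2) = \<one>" by (simp add: wk T_trivial_if_dvd)
    then have "int p ^ 3 dvd int p ^ 2" by (simp add: w_pow_eq_one_iff)
    then have "p ^ 3 dvd p ^ 2" by (simp flip: of_nat_power)
    then show False
      using prime by (simp add: power_dvd_imp_le prime_gt_1_nat dvd_power_iff)
  qed
  let ?y = "case_H_gen (a \<otimes> w [^] int p) (b \<otimes> w [^] int p) (c \<otimes> d [^] k) d"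
  have y_closed: "?y i \<in> carrier G" for i
    by (cases i) simp_all
  have wp: "coords (w [^] int p) (\<lambda>_. 0) (int p)"
    using coords_int_pow[OF coords_gens(5), of "int p"] by simp
  have ya: "coords (a \<otimes> w [^] int p) (case_H_gen 1 0 0 0) (int p)"
    using coords_mult[OF coords_gens(1) wp] by simp
  have yb: "coords (b \<otimes> w [^] int p) (case_H_gen 0 1 0 0) (int p)"
    using coords_mult[OF coords_gens(2) wp] by simp
  have eta: "(\<lambda>i. case_H_gen u1 u2 u3 u4 i + j * case_H_gen v1 v2 v3 v4 i)
      = case_H_gen (u1 + j * v1) (u2 + j * v2) (u3 + j * v3) (u4 + j * v4)" for u1 u2 u3 u4 v1 v2 v3 v4 j :: int
    by (rule ext) (simp split: H_gen.split)
  have yc: "coords (c \<otimes> d [^] k) (case_H_gen 0 0 1 k) 0"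
    using coords_mult[OF coords_gens(3) coords_int_pow[OF coords_gens(4), of k]] by (simp add: eta)
  have ycd: "coords (c \<otimes> d [^] k \<otimes> d) (case_H_gen 0 0 1 (k + 1)) 0"
    using coords_mult[OF yc coords_gens(4)] eta[of _ _ _ _ 1] by simp
  have ybc: "coords (b \<otimes> w [^] int p \<otimes> (c \<otimes> d [^] k)) (case_H_gen 0 1 1 k) (int p)"
    using coords_mult[OF yb yc] eta[of _ _ _ _ 1] by simp
  have ybcd: "coords (b \<otimes> w [^] int p \<otimes> (c \<otimes> d [^] k) \<otimes> d) (case_H_gen 0 1 1 (k + 1)) (int p)"
    using coords_mult[OF ybc coords_gens(4)] eta[of _ _ _ _ 1] by simp
  have wpp: "w [^] (int p * int p) = T 0 0 k 0 0 0"
    using wk by (simp add: power2_eq_square)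
  have rels: "term_eval G ?y s = term_eval G ?y t" if "(s, t) \<in> H_relations p" for s t
  proof -
    have class2: "commutator G (commutator G x y) z = \<one>" if xyz: "x \<in> carrier G" "y \<in> carrier G" "z \<in> carrier G" for x y z
    proof -
      obtain u n v m where "coords x u n" "coords y v m" using coords_exist xyz by meson
      then have "commutator G x y \<in> center G"
        by (simp add: coords_commutator T_center)
      then show ?thesis
        using that centerD by (simp add: commutator_eq_one_iff)
    qed
    \<comment> \<open>With \<open>w^(p^2) = [a,d]^k\<close>, both sides of the relations for
      \<open>a\<close> and \<open>b\<close> gain \<open>[a,d]^k\<close>, and both sides of the one
      for \<open>c\<close> gain \<open>[b,d]^k\<close>. In the relation for \<open>b\<close> the
      commutator of \<open>a\<close> and \<open>w^p\<close> also appears, as a \<open>p\<close>-th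
      power of \<open>[b,d]\<close>, so that equality holds only after reduction modulo
      \<open>p\<close>.\<close>
    have "(a \<otimes> w [^] int p) [^] p = commutator G (a \<otimes> w [^] int p) (c \<otimes> d [^] k)"
      using coords_pow_p[OF ya] coords_commutator[OF ya yc] by (simp add: wpp T_add)
    moreover have "(b \<otimes> w [^] int p) [^] p = commutator G (a \<otimes> w [^] int p) (b \<otimes> w [^] int p \<otimes> (c \<otimes> d [^] k) \<otimes> d)"
      using coords_pow_p[OF yb] coords_commutator[OF ya ybcd] by (simp add: wpp T_add T_eq_iff)
    moreover have "(c \<otimes> d [^] k) [^] p = commutator G (b \<otimes> w [^] int p) (c \<otimes> d [^] k \<otimes> d)"
      using coords_pow_p[OF yc] coords_commutator[OF yb ycd] by (simp add: T_add add.commute)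
    moreover have "d [^] p = commutator G (b \<otimes> w [^] int p) d"
      using coords_commutator[OF yb coords_gens(4)] by (simp add: powers_T)
    ultimately show ?thesis
      using that y_closed
      by (auto simp: H_relations_def term_eval_Comm term_eval_Pow class2 term_eval_closed)
  qed
  from von_dyck[OF subgroup_H pres is_group y_closed rels]
  obtain \<phi> where \<phi>: "\<phi> \<in> hom (G\<lparr>carrier := H\<rparr>) G" and \<phi>y: "\<And>i. \<phi> (gens i) = ?y i"
    by blast
  interpret \<phi>: group_hom "G\<lparr>carrier := H\<rparr>" G \<phi>
    using \<phi> subgroup_imp_group[OF subgroup_H] is_group by (simp add: group_hom_def group_hom_axioms_def)
  have \<phi>g: "\<phi> a = a \<otimes> w [^] int p" "\<phi> b = b \<otimes> w [^] int p" "\<phi> c = c \<otimes> d [^] k" "\<phi> d = d"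
    using \<phi>y[of A] \<phi>y[of B] \<phi>y[of C] \<phi>y[of D] by simp_all
  have \<phi>m: "\<phi> (x \<otimes> y) = \<phi> x \<otimes> \<phi> y" if "x \<in> H" "y \<in> H" for x y
    using \<phi>.hom_mult that by simp
  have \<phi>i: "\<phi> (inv x) = inv (\<phi> x)" if "x \<in> H" for x
    using \<phi>.hom_inv[of x] that by (simp add: m_inv_consistent[OF subgroup_H])
  have \<phi>c: "\<phi> x \<in> carrier G" if "x \<in> H" for x
    using \<phi>.hom_closed[of x] that by simp
  have \<phi>p: "\<phi> (x [^] (n::int)) = \<phi> x [^] n" if "x \<in> H" for x n
    using \<phi>.hom_int_pow[of x n] that by (simp add: int_pow_consistent[OF subgroup_H])
  have \<phi>comm: "\<phi> (commutator G x y) = commutator G (\<phi> x) (\<phi> y)" if "x \<in> H" "y \<in> H" for x y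
    using that subgroup_H by (simp add: commutator_def \<phi>m \<phi>i subgroup.m_closed subgroup.m_inv_closed)
  have conj: "\<phi> (w \<otimes> h \<otimes> inv w) \<otimes> w = w \<otimes> \<phi> h" if h: "h \<in> H" for h
  proof -
    interpret nH: normal H G by (rule normal_H)
    let ?c = "\<lambda>x. w \<otimes> x \<otimes> inv w"
    have cH: "?c x \<in> H" if "x \<in> H" for x using that nH.inv_op_closed2 by simp
    have cm: "?c (x \<otimes> y) = ?c x \<otimes> ?c y" if "x \<in> carrier G" "y \<in> carrier G" for x y
      using that by (simp add: m_assoc inv_solve_left)
    have ci: "?c (inv x) = inv (?c x)" if "x \<in> carrier G" for x
      using that by (simp add: inv_mult_group m_assoc)
    have wwp: "?c (w [^] int p) = w [^] int p"
      using int_pow_commute[of w w 1 "int p"] by (simp add: inv_solve_right')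
    have gen: "\<phi> (?c (gens i)) = ?c (\<phi> (gens i))" for i
    proof (cases i)
      case A
      have "d [^] p \<in> H" using gens_H subgroup_H by (simp add: powers_T T_H)
      moreover have "\<phi> (d [^] p) = d [^] p"
        using \<phi>p[of d "int p"] gens_H by (simp add: int_pow_int \<phi>g)
      moreover have "w [^] int p \<otimes> d [^] p = d [^] p \<otimes> w [^] int p"
        by (simp add: powers_T T_commute)
      ultimately show ?thesis
        by (simp add: A wa gens_H \<phi>m \<phi>g cm wwp) (simp add: m_assoc)
    next
      case B
      then show ?thesis by (simp add: wb \<phi>g cm wwp)
    next
      case C
      have "?c (d [^] k) = d [^] k" using conj_int_pow[of w d k] by (simp add: wd)
      then show ?thesis by (simp add: C wc \<phi>g cm)
    next
      case D
      then show ?thesis by (simp add: wd \<phi>g)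
    qed
    \<comment> \<open>Compatibility with conjugation by \<open>w\<close> has been checked on
      generators; induction over the words that spell the elements of \<open>H\<close> spreads it to
      \<open>H\<close>.\<close>
    have "\<phi> (?c (ev s)) = ?c (\<phi> (ev s))" for s
    proof (induction s)
      case (Gen i) then show ?case using gen by simp
    next
      case Unit then show ?case using \<phi>.hom_one by simp
    next
      case (Mult s t)
      then show ?case using ev_H[of s] ev_H[of t] by (simp add: cm H_closed \<phi>m cH \<phi>c)
    next
      case (Inv s)
      then show ?case using ev_H[of s] by (simp add: ci H_closed \<phi>i cH \<phi>c)
    qed
    then have "\<phi> (?c h) = ?c (\<phi> h)" using h ev_facts(2) by (metis imageE)
    then show ?thesis using \<phi>c[OF h] by (simp add: m_assoc)
  qed
  have agree: "\<phi> (w [^] n) = w [^] n" if wH: "w [^] n \<in> H" for n :: int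
  proof -
    obtain j where "n = int p ^ 2 * j"
      using wH by (auto simp: w_pow_H_iff elim: dvdE)
    then have "w [^] n = (w [^] (int p ^ 2)) [^] j"
      by (simp add: int_pow_pow)
    then have n: "w [^] n = commutator G a d [^] (k * j)"
      by (simp add: wk T_pow T_units mult.commute)
    \<comment> \<open>The factor \<open>w^p\<close> in the image of \<open>a\<close> is central and
      \<open>d\<close> is fixed, so \<open>\<phi>\<close> fixes \<open>[a,d]\<close> and with it
      every power of \<open>w\<close> in \<open>H\<close>. Hence \<open>w\<close> itself may be sent
      to \<open>w\<close>.\<close>
    have "\<phi> (commutator G a d) = commutator G a d"
      using \<phi>comm[of a d] gens_H coords_commutator[OF ya coords_gens(4)] coords_commutator[OF coords_gens(1,4)]
      by (simp add: \<phi>g)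
    then show ?thesis
      unfolding n using \<phi>p commutator_H gens_H by simp
  qed
  have "carrier G = H <#> generate G {w}"
    using amalg by (simp add: amalgamated_semidirect_product_def)
  from amalgamated_cyclic_hom_extension[OF normal_H w_closed this is_group w_closed \<phi> conj agree]
  obtain F where F: "F \<in> hom G G" and Fh: "\<And>h. h \<in> H \<Longrightarrow> F h = \<phi> h" and Fw: "F w = w"
    by blast
  interpret F: group_hom G G F
    using F by (simp add: group_hom_def group_hom_axioms_def is_group)
  have Fg: "F a = a \<otimes> w [^] int p" "F b = b \<otimes> w [^] int p" "F c = c \<otimes> d [^] k" "F d = d"
    using Fh gens_H \<phi>g by simp_all
  \<comment> \<open>Since \<open>w\<close> and \<open>d\<close> are fixed, the image contains
    \<open>w^p\<close> and \<open>d^k\<close> and these can be divided out of the images of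
    \<open>a\<close>, \<open>b\<close>, \<open>c\<close>. Finiteness then gives injectivity.\<close>
  have "F ` carrier G = carrier G"
  proof (rule subgroup_with_gens)
    show img: "subgroup (F ` carrier G) G" by (rule F.img_is_subgroup)
    show w: "w \<in> F ` carrier G" using Fw by (metis imageI w_closed)
    show d: "d \<in> F ` carrier G" using Fg(4) by (metis imageI gens_closed(4))
    have div: "x \<in> F ` carrier G" if "x \<otimes> y \<in> F ` carrier G" "y \<in> F ` carrier G" "x \<in> carrier G" "y \<in> carrier G" for x y
    proof -
      have "x \<otimes> y \<otimes> inv y \<in> F ` carrier G"
        using that img by (simp add: subgroup.m_closed subgroup.m_inv_closed)
      then show ?thesis using that by (simp add: m_assoc)
    qed
    have wp: "w [^] int p \<in> F ` carrier G" and dk: "d [^] k \<in> F ` carrier G"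
      using w d img by (simp_all add: subgroup_int_pow_closed)
    show "a \<in> F ` carrier G" "b \<in> F ` carrier G"
      using div[OF _ wp] Fg(1,2) by (metis imageI gens_closed(1,2) int_pow_closed w_closed)+
    show "c \<in> F ` carrier G"
      using div[OF _ dk] Fg(3) by (metis imageI gens_closed(3,4) int_pow_closed)
  qed
  moreover have "finite (carrier G)"
    using order_G p_pos by (metis order_def card_ge_0_finite zero_less_power)
  ultimately have "bij_betw F (carrier G) (carrier G)"
    by (simp add: bij_betw_def eq_card_imp_inj_on)
  then have F_auto: "restrict F (carrier G) \<in> auto G"
    using F by (auto simp: auto_def Bij_def hom_def)
  have "(\<lambda>x\<in>carrier G. c \<otimes> x \<otimes> inv c) \<in> auto G"
    using conjugation_auto[of "carrier G" c] normal_self by simp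
  then have "miller_group G \<Longrightarrow> F (c \<otimes> b \<otimes> inv c) = c \<otimes> F b \<otimes> inv c"
    using F_auto unfolding miller_group_def comm_AutoGroup_iff by fastforce
  moreover have "F (c \<otimes> b \<otimes> inv c) \<noteq> c \<otimes> F b \<otimes> inv c"
  proof
    assume "F (c \<otimes> b \<otimes> inv c) = c \<otimes> F b \<otimes> inv c"
    \<comment> \<open>Evaluated at \<open>b\<close>, commuting with conjugation by \<open>c\<close>
      would make these two commutators equal. Their \<open>[b,d]\<close>-entries are
      \<open>- k\<close> and \<open>0\<close>, and \<open>p\<close> does not divide \<open>k\<close>
      because \<open>w^(p^2)\<close> is nontrivial.\<close>
    then have "commutator G (c \<otimes> d [^] k) (b \<otimes> w [^] int p) = commutator G c (b \<otimes> w [^] int p)"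
      by (simp add: Fg commutator_def)
    then have "int p dvd k"
      by (simp add: coords_commutator[OF yc yb] coords_commutator[OF coords_gens(3) yb] T_eq_iff)
    then show False using k by simp
  qed
  ultimately show ?thesis by blast
qed

end

theorem theoremB:
  fixes p :: nat
    and G :: "('g, 'm) monoid_scheme" (structure)
    and H M :: "'g set"
    and a b c d w :: 'g
  assumes "Factorial_Ring.prime p" and "odd p"
    and "group G"
    and "presented_by (G\<lparr>carrier := H\<rparr>) (H_relations p) (case_H_gen a b c d)"
    and "w \<in> carrier G" and "group.ord G w = p ^ 3"
    and "subgroup M G" and "M \<subseteq> derived G H" and "card M = p"
    and "\<not> M \<subseteq> power_subgroup G H p"
    and "amalgamated_semidirect_product G H (generate G {w}) M"
    and "M = generate G {w [^] (p ^ 2)}"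
    and "w \<otimes> a \<otimes> inv w = a \<otimes> d [^] p"
    and "w \<otimes> b \<otimes> inv w = b"
    and "w \<otimes> c \<otimes> inv w = c"
    and "w \<otimes> d \<otimes> inv w = d"
  shows "central_automorphism (G\<lparr>carrier := H\<rparr>) (\<lambda>h\<in>H. w \<otimes> h \<otimes> inv w)
    \<and> \<not> inner_automorphism (G\<lparr>carrier := H\<rparr>) (\<lambda>h\<in>H. w \<otimes> h \<otimes> inv w)
    \<and> order G = p ^ 12
    \<and> \<not> special_p_group p G
    \<and> (M = generate G {commutator G a b} \<longrightarrow> miller_group G)
    \<and> (M = generate G {commutator G a d} \<longrightarrow> \<not> miller_group G)"
proof -
  interpret amalgam G p H a b c d w
    using assms by (simp add: amalgam_def amalgam_axioms_def)
  show ?thesis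
    using central_automorphism_w not_inner_w order_G not_special miller_if_ab not_miller_if_ad
      \<open>M = generate G {w [^] (p ^ 2)}\<close> by simp
qed
end
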